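(* Let $W$ be a tournamenton, let $T_n\sim T(n,W)$, and let $$\hat\sigma_{T_n}^2=t(\vec B,W^{T_n})-t(\vec C_3,W^{T_n})^2 .$$ Then the following hold as $n\to\infty$: (1) When $W$ is $\triangle$-regular, $n\,\hat\sigma_{T_n}^2=O_P(1)$. (2) When $W$ is not $\triangle$-regular, $\hat\sigma^2_{T_n}\xrightarrow{P}\sigma_W^2>0$, where $\sigma_W^2=t(\vec B,W)-t(\vec C_3,W)^2$.
   Context: A tournamenton is a measurable function $W:[0,1]^2\to[0,1]$ with $W(x,y)+W(y,x)=1$ for all $x,y$. The $W$-random tournament $T_n\sim T(n,W)$ on $[n]$ has adjacency matrix $(a_{uv})$: $\eta_1,\dots,\eta_n$ are i.i.d. $\mathrm{Unif}([0,1])$ and, conditionally, $a_{uv}\sim\mathrm{Ber}(W(\eta_u,\eta_v))$ independently for $u<v$, $a_{vu}=1-a_{uv}$, and $a_{uu}=\frac12$. For a directed graph $H=(V(H),E(H))$, $t(H,W)=\int_{[0,1]^{|V(H)|}}\prod_{(s,t)\in E(H)}W(x_s,x_t)\prod_{s\in V(H)}\mathrm dx_s$. $\vec C_3$ is the directed 3-cycle; $\vec B$ is the directed graph on 5 vertices obtained by joining two directed 3-cycles at a common vertex. The empirical tournamenton $W^{T_n}$ is $W^{T_n}(x,y)=a_{\lceil nx\rceil\lceil ny\rceil}$, so that $t(H,W^{T_n})=n^{-|V(H)|}\sum_{\boldsymbol s\in[n]^{V(H)}}\prod_{(u,v)\in E(H)}a_{s_us_v}$ (including the diagonal value $a_{uu}=\frac12$).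 $W$ is $\triangle$-regular if $t_W^\triangle(x)=\int_{[0,1]^2}W(x,y)W(y,z)W(z,x)\,\mathrm dy\,\mathrm dz$ is constant for almost every $x\in[0,1]$. *)

theory Defs
  imports "HOL-Probability.Probability" "Graph_Theory.Pair_Digraph"
begin

text \<open>Lebesgue measure on $[0,1]$, the law $\mathrm{Unif}([0,1])$. Its space is the unit interval
  itself, so no condition is ever imposed on a kernel outside $[0,1]^2$.\<close>

definition unif01 :: "real measure" where
  "unif01 = restrict_space lborel {0..1}"

lemma prob_space_unif01: "prob_space unif01"
  by (rule prob_spaceI) (simp add: unif01_def space_restrict_space emeasure_restrict_space)

lemma space_unif01: "space unif01 = {0..1}"
  by (simp add: unif01_def space_restrict_space)

definition tournamenton :: "(real \<Rightarrow> real \<Rightarrow> real) \<Rightarrow> bool" where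
  "tournamenton W \<longleftrightarrow>
     case_prod W \<in> borel_measurable (unif01 \<Otimes>\<^sub>M unif01) \<and>
     (\<forall>x\<in>{0..1}. \<forall>y\<in>{0..1}. W x y \<in> {0..1} \<and> W x y + W y x = 1)"

definition hom_density :: "'v pair_pre_digraph \<Rightarrow> (real \<Rightarrow> real \<Rightarrow> real) \<Rightarrow> real" where
  "hom_density H W =
     (\<integral>x. (\<Prod>(s, t)\<in>parcs H. W (x s) (x t)) \<partial>(\<Pi>\<^sub>M s\<in>pverts H. unif01))"

definition C3 :: "nat pair_pre_digraph" where
  "C3 = \<lparr> pverts = {0, 1, 2}, parcs = {(0, 1), (1, 2), (2, 0)} \<rparr>"

definition bowtie :: "nat pair_pre_digraph" where
  "bowtie = \<lparr> pverts = {0, 1, 2, 3, 4},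
     parcs = {(0, 1), (1, 2), (2, 0), (0, 3), (3, 4), (4, 0)} \<rparr>"

definition tri_density :: "(real \<Rightarrow> real \<Rightarrow> real) \<Rightarrow> real \<Rightarrow> real" where
  "tri_density W x = (\<integral>(y, z). W x y * W y z * W z x \<partial>(unif01 \<Otimes>\<^sub>M unif01))"

definition tri_regular :: "(real \<Rightarrow> real \<Rightarrow> real) \<Rightarrow> bool" where
  "tri_regular W \<longleftrightarrow> (\<exists>c. AE x in unif01. tri_density W x = c)"

text \<open>An adjacency matrix on $[n]$ is a function on pairs of naturals that vanishes outside
  $[n] \times [n]$ (an arbitrary convention). It is determined by the outcomes \<open>e (u, v)\<close> of the pairs $u < v$.\<close>

definition adj_matrix :: "nat \<Rightarrow> (nat \<times> nat \<Rightarrow> bool) \<Rightarrow> nat \<Rightarrow> nat \<Rightarrow> real" where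
  "adj_matrix n e u v =
     (if u \<notin> {1..n} \<or> v \<notin> {1..n} then 0
      else if u = v then 1 / 2
      else if u < v then of_bool (e (u, v))
      else 1 - of_bool (e (v, u)))"

definition cond_tournament ::
    "nat \<Rightarrow> (real \<Rightarrow> real \<Rightarrow> real) \<Rightarrow> (nat \<Rightarrow> real) \<Rightarrow> (nat \<Rightarrow> nat \<Rightarrow> real) pmf" where
  "cond_tournament n W \<eta> =
     map_pmf (adj_matrix n)
       (Pi_pmf {(u, v). 1 \<le> u \<and> u < v \<and> v \<le> n} False
          (\<lambda>(u, v). bernoulli_pmf (W (\<eta> u) (\<eta> v))))"

text \<open>The law $T(n,W)$ of the adjacency matrix: first draw $\eta_1,\dots,\eta_n$ i.i.d.\ uniformly,
  then draw the entries conditionally on $\eta$. Only finitely many matrices occur, so the space of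
  matrices carries the discrete $\sigma$-algebra.\<close>

definition random_tournament ::
    "nat \<Rightarrow> (real \<Rightarrow> real \<Rightarrow> real) \<Rightarrow> (nat \<Rightarrow> nat \<Rightarrow> real) measure" where
  "random_tournament n W =
     (\<Pi>\<^sub>M u\<in>{1..n}. unif01) \<bind> (\<lambda>\<eta>. measure_pmf (cond_tournament n W \<eta>))"

text \<open>The kernel is measurable, so the bind above is a genuine mixture.\<close>

lemma measurable_W_pair:
  assumes "tournamenton W" "u \<in> {1..n}" "v \<in> {1..n}"
  shows "(\<lambda>\<eta>. W (\<eta> u) (\<eta> v)) \<in> borel_measurable (\<Pi>\<^sub>M u\<in>{1..n}. unif01)"
proof -
  have [measurable]: "case_prod W \<in> borel_measurable (unif01 \<Otimes>\<^sub>M unif01)"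
    using assms by (simp add: tournamenton_def)
  have [measurable]: "(\<lambda>\<eta>. (\<eta> u, \<eta> v)) \<in> (\<Pi>\<^sub>M u\<in>{1..n}. unif01) \<rightarrow>\<^sub>M unif01 \<Otimes>\<^sub>M unif01"
    using assms by measurable
  have "(\<lambda>\<eta>. case_prod W (\<eta> u, \<eta> v)) \<in> borel_measurable (\<Pi>\<^sub>M u\<in>{1..n}. unif01)"
    by measurable
  then show ?thesis by simp
qed

lemma cond_tournament_kernel:
  assumes W: "tournamenton W"
  shows "(\<lambda>\<eta>. measure_pmf (cond_tournament n W \<eta>))
    \<in> (\<Pi>\<^sub>M u\<in>{1..n}. unif01) \<rightarrow>\<^sub>M prob_algebra (count_space UNIV)"
proof (rule measurable_prob_algebraI)
  show "prob_space (measure_pmf (cond_tournament n W \<eta>))" for \<eta>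
    by (rule measure_pmf.prob_space_axioms)
next
  let ?P = "{(u, v). 1 \<le> u \<and> u < v \<and> v \<le> n}"
  let ?F = "PiE_dflt ?P False (\<lambda>_. UNIV)"
  have P: "finite ?P" by (rule finite_subset[of _ "{1..n} \<times> {1..n}"]) auto
  have F: "finite ?F" using P by (intro finite_PiE_dflt) auto
  show "(\<lambda>\<eta>. measure_pmf (cond_tournament n W \<eta>))
    \<in> (\<Pi>\<^sub>M u\<in>{1..n}. unif01) \<rightarrow>\<^sub>M subprob_algebra (count_space UNIV)"
  proof (rule measurable_subprob_algebra)
    fix A :: "(nat \<Rightarrow> nat \<Rightarrow> real) set"
    let ?p = "\<lambda>\<eta>. Pi_pmf ?P False (\<lambda>(u, v). bernoulli_pmf (W (\<eta> u) (\<eta> v)))"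
    have eq: "emeasure (measure_pmf (cond_tournament n W \<eta>)) A
        = ennreal (\<Sum>e\<in>?F \<inter> adj_matrix n -` A. \<Prod>(u,v)\<in>?P. 
            (if e (u,v) then W (\<eta> u) (\<eta> v) else 1 - W (\<eta> u) (\<eta> v)))"
      if \<eta>: "\<eta> \<in> space (\<Pi>\<^sub>M u\<in>{1..n}. unif01)" for \<eta>
    proof -
      have r: "\<eta> u \<in> {0..1}" if "u \<in> {1..n}" for u
        using \<eta> that by (auto simp: space_PiM space_unif01 PiE_def Pi_def)
      have r2: "W (\<eta> u) (\<eta> v) \<in> {0..1}" if "(u,v) \<in> ?P" for u v
        using r[of u] r[of v] that W unfolding tournamenton_def by (metis (no_types, lifting) Ball_def atLeastAtMost_iff
            case_prodD le_trans less_imp_le_nat mem_Collect_eq)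
      have "emeasure (measure_pmf (cond_tournament n W \<eta>)) A = emeasure (measure_pmf (?p \<eta>)) (adj_matrix n -` A)"
        by (simp add: cond_tournament_def)
      also have "\<dots> = emeasure (measure_pmf (?p \<eta>)) (adj_matrix n -` A \<inter> ?F)"
      proof (rule emeasure_eq_AE)
        show "AE x in measure_pmf (?p \<eta>). (x \<in> adj_matrix n -` A) = (x \<in> adj_matrix n -` A \<inter> ?F)"
        proof -
          have "set_pmf (?p \<eta>) \<subseteq> ?F"
            using set_Pi_pmf_subset[OF P, of False "\<lambda>(u, v). bernoulli_pmf (W (\<eta> u) (\<eta> v))"]
            unfolding PiE_dflt_def by blast
          then show ?thesis by (auto simp only: AE_measure_pmf_iff)
        qed
      qed auto
      also have "\<dots> = ennreal (\<Sum>e\<in>?F \<inter> adj_matrix n -` A. pmf (?p \<eta>) e)"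
        using F by (simp add: measure_pmf.emeasure_eq_measure measure_measure_pmf_finite Int_commute)
      also have "(\<Sum>e\<in>?F \<inter> adj_matrix n -` A. pmf (?p \<eta>) e) = (\<Sum>e\<in>?F \<inter> adj_matrix n -` A. \<Prod>(u,v)\<in>?P. 
            (if e (u,v) then W (\<eta> u) (\<eta> v) else 1 - W (\<eta> u) (\<eta> v)))"
      proof (rule sum.cong[OF refl])
        fix e assume "e \<in> ?F \<inter> adj_matrix n -` A"
        then have "\<And>x. x \<notin> ?P \<Longrightarrow> e x = False" by (auto simp: PiE_dflt_def)
        then show "pmf (?p \<eta>) e = (\<Prod>(u,v)\<in>?P. 
            (if e (u,v) then W (\<eta> u) (\<eta> v) else 1 - W (\<eta> u) (\<eta> v)))"
          using r2 by (subst pmf_Pi'[OF P]) (auto intro!: prod.cong)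
      qed
      finally show ?thesis .
    qed
    have "(\<lambda>\<eta>. ennreal (\<Sum>e\<in>?F \<inter> adj_matrix n -` A. \<Prod>(u,v)\<in>?P. 
            (if e (u,v) then W (\<eta> u) (\<eta> v) else 1 - W (\<eta> u) (\<eta> v)))) \<in> borel_measurable (\<Pi>\<^sub>M u\<in>{1..n}. unif01)"
    proof (intro measurable_compose[OF _ measurable_ennreal] borel_measurable_sum borel_measurable_prod, clarify)
      fix e u v assume "1 \<le> u" "u < v" "v \<le> n"
      then have [measurable]: "(\<lambda>\<eta>. W (\<eta> u) (\<eta> v)) \<in> borel_measurable (\<Pi>\<^sub>M u\<in>{1..n}. unif01)"
        by (intro measurable_W_pair[OF W]) auto
      show "(\<lambda>\<eta>. if e (u,v) then W (\<eta> u) (\<eta> v) else 1 - W (\<eta> u) (\<eta> v)) \<in> borel_measurable (\<Pi>\<^sub>M u\<in>{1..n}. unif01)"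
        by measurable
    qed
    then show "(\<lambda>\<eta>. emeasure (measure_pmf (cond_tournament n W \<eta>)) A) \<in> borel_measurable (\<Pi>\<^sub>M u\<in>{1..n}. unif01)"
      by (subst measurable_cong[OF eq])
  qed (auto intro: measure_pmf.subprob_space_axioms)
qed

lemma prob_space_random_tournament:
  assumes "tournamenton W"
  shows "prob_space (random_tournament n W)" "sets (random_tournament n W) = UNIV"
proof -
  interpret U: prob_space unif01 by (rule prob_space_unif01)
  have p: "(\<Pi>\<^sub>M u\<in>{1..n}. unif01) \<in> space (prob_algebra (\<Pi>\<^sub>M u\<in>{1..n}. unif01))"
    by (auto simp: space_prob_algebra intro!: prob_space_PiM prob_space_unif01)
  show "prob_space (random_tournament n W)"
    unfolding random_tournament_def
    by (rule prob_space_bind'[OF p cond_tournament_kernel[OF assms]])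
  show "sets (random_tournament n W) = UNIV"
    unfolding random_tournament_def
    by (subst sets_bind'[OF p cond_tournament_kernel[OF assms]]) simp
qed

definition empirical :: "nat \<Rightarrow> (nat \<Rightarrow> nat \<Rightarrow> real) \<Rightarrow> real \<Rightarrow> real \<Rightarrow> real" where
  "empirical n a x y = a (nat \<lceil>real n * x\<rceil>) (nat \<lceil>real n * y\<rceil>)"

definition sigma2 :: "(real \<Rightarrow> real \<Rightarrow> real) \<Rightarrow> real" where
  "sigma2 W = hom_density bowtie W - (hom_density C3 W)\<^sup>2"

text \<open>$X_n = O_P(1)$ and $X_n \to c$ in probability, where $X_n$ is defined on its own probability
  space \<open>M n\<close>.\<close>

definition bounded_in_prob :: "(nat \<Rightarrow> 'w measure) \<Rightarrow> (nat \<Rightarrow> 'w \<Rightarrow> real) \<Rightarrow> bool" where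
  "bounded_in_prob M X \<longleftrightarrow>
     (\<forall>\<epsilon>>0. \<exists>K. \<forall>\<^sub>F n in sequentially.
        measure (M n) {\<omega> \<in> space (M n). \<bar>X n \<omega>\<bar> > K} < \<epsilon>)"

definition tendsto_in_prob :: "(nat \<Rightarrow> 'w measure) \<Rightarrow> (nat \<Rightarrow> 'w \<Rightarrow> real) \<Rightarrow> real \<Rightarrow> bool" where
  "tendsto_in_prob M X c \<longleftrightarrow>
     (\<forall>\<epsilon>>0. (\<lambda>n. measure (M n) {\<omega> \<in> space (M n). \<bar>X n \<omega> - c\<bar> > \<epsilon>}) \<longlonglongrightarrow> 0)"

end

theory Submission
  imports Defs
begin

text \<open>
For a kernel $U$, fixing the common vertex of the two cycles of $\vec B$ shows that
$t(\vec B, U) = \int t_U^\triangle(x)^2 \, dx$, while $t(\vec C_3, U) = \int t_U^\triangle(x) \, dx$. Hence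
\<open>sigma2 U\<close> is the variance of $t_U^\triangle$ under the uniform law (\<open>sigma2_variance\<close>). It is
nonnegative, and it vanishes exactly when $U$ is $\triangle$-regular. This holds for $W$ as well as for
the empirical tournamenton.

The probabilistic input is a single bias estimate, \<open>expectation_hom_density\<close>: for every oriented graph
$H$, the expected density of $H$ in the empirical tournamenton differs from $t(H, W)$ by at most
$|V(H)|^2/n$. Points of $[0,1]^{V(H)}$ in distinct cells pick distinct vertices of the random
tournament; the arcs of $H$ then use distinct, conditionally independent entries, and averaging gives
$t(H, W)$ exactly. Only points that share a cell contribute an error.

Since $t(H, U)^2$ is the density of two disjoint copies of $H$, the same estimate applied to the
doubled graph bounds the mean squared error of every empirical density by a constant over $n$
(\<open>second_moment_hom_density\<close>). So the estimator, a polynomial in two densities, is within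
$O(n^{-1/2})$ of $\sigma_W^2$ in mean square, and Chebyshev's inequality proves convergence in
probability.

In the regular case this rate is too weak. Put $c = t(\vec C_3, W)$. Because
$\hat\sigma^2 \le t(\vec B, W^{T_n}) - 2 c \, t(\vec C_3, W^{T_n}) + c^2$ and the right-hand side is linear
in densities, its expectation is the limiting value $\sigma_W^2 = 0$ up to $O(1/n)$. As the estimator is
nonnegative, Markov's inequality gives $n \hat\sigma^2 = O_P(1)$.
\<close>

section \<open>Densities of oriented graphs in kernels\<close>

definition unit_kernel :: "(real \<Rightarrow> real \<Rightarrow> real) \<Rightarrow> bool" where
  "unit_kernel U \<longleftrightarrow>
     case_prod U \<in> borel_measurable (unif01 \<Otimes>\<^sub>M unif01) \<and>
     (\<forall>x\<in>{0..1}. \<forall>y\<in>{0..1}. U x y \<in> {0..1})"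

lemma unit_kernel_tournamenton: "tournamenton W \<Longrightarrow> unit_kernel W"
  by (auto simp: tournamenton_def unit_kernel_def)

lemma unit_kernel_measurable:
  assumes "unit_kernel U" "f \<in> M \<rightarrow>\<^sub>M unif01" "g \<in> M \<rightarrow>\<^sub>M unif01"
  shows "(\<lambda>x. U (f x) (g x)) \<in> borel_measurable M"
proof -
  have "case_prod U \<in> borel_measurable (unif01 \<Otimes>\<^sub>M unif01)"
    using assms(1) by (simp add: unit_kernel_def)
  from measurable_compose[OF measurable_Pair[OF assms(2,3)] this] show ?thesis
    by simp
qed

text \<open>The integrand of the homomorphism density. The kernel may live on any type, so that the same
function is evaluated at a kernel on $[0,1]$, at its empirical counterpart, and at an adjacency
matrix, whose rows are indexed by vertices.\<close>

definition arc_prod :: "('v \<times> 'v) set \<Rightarrow> ('b \<Rightarrow> 'b \<Rightarrow> real) \<Rightarrow> ('v \<Rightarrow> 'b) \<Rightarrow> real" where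
  "arc_prod A U x = (\<Prod>(s, t)\<in>A. U (x s) (x t))"

lemma arc_prod_unit:
  assumes "\<And>s t. (s, t) \<in> A \<Longrightarrow> U (x s) (x t) \<in> {0..1}"
  shows "arc_prod A U x \<in> {0..1}"
  using assms unfolding arc_prod_def
  by (auto intro!: prod_nonneg prod_le_1 simp: case_prod_beta)

text \<open>Taking $u = v$ in the last condition also excludes loops. An oriented graph uses each unordered
pair of vertices at most once, so its arcs correspond to independent entries of the adjacency matrix.\<close>

definition oriented_graph :: "'v pair_pre_digraph \<Rightarrow> bool" where
  "oriented_graph H \<longleftrightarrow> finite (pverts H) \<and> parcs H \<subseteq> pverts H \<times> pverts H \<and>
     (\<forall>u v. (u, v) \<in> parcs H \<longrightarrow> (v, u) \<notin> parcs H)"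

lemma oriented_graphD:
  assumes "oriented_graph H"
  shows "finite (pverts H)" "parcs H \<subseteq> pverts H \<times> pverts H" "finite (parcs H)"
    "\<And>u v. (u, v) \<in> parcs H \<Longrightarrow> (v, u) \<notin> parcs H"
  using assms finite_subset[of "parcs H" "pverts H \<times> pverts H"]
  by (auto simp: oriented_graph_def)

lemma hom_density_arc_prod:
  "hom_density H U = (\<integral>x. arc_prod (parcs H) U x \<partial>(\<Pi>\<^sub>M s\<in>pverts H. unif01))"
  by (simp add: hom_density_def arc_prod_def)

lemma arc_prod_measurable:
  assumes "unit_kernel U" "A \<subseteq> V \<times> V"
  shows "arc_prod A U \<in> borel_measurable (\<Pi>\<^sub>M s\<in>V. unif01)"
  unfolding arc_prod_def
proof (intro borel_measurable_prod, clarify)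
  fix s t assume "(s, t) \<in> A"
  with assms(2) have "s \<in> V" "t \<in> V" by auto
  then show "(\<lambda>x. U (x s) (x t)) \<in> borel_measurable (\<Pi>\<^sub>M s\<in>V. unif01)"
    by (intro unit_kernel_measurable[OF assms(1)] measurable_component_singleton)
qed

lemma arc_prod_unit_space:
  assumes "unit_kernel U" "A \<subseteq> V \<times> V" "x \<in> space (\<Pi>\<^sub>M s\<in>V. unif01)"
  shows "arc_prod A U x \<in> {0..1}"
proof (rule arc_prod_unit)
  fix s t assume "(s, t) \<in> A"
  with assms(2) have "s \<in> V" "t \<in> V" by auto
  with assms(3) have "x s \<in> {0..1}" "x t \<in> {0..1}"
    by (auto simp: space_PiM space_unif01 PiE_iff)
  with assms(1) show "U (x s) (x t) \<in> {0..1}" by (auto simp: unit_kernel_def)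
qed

lemma prob_space_PiM_unif01: "prob_space (\<Pi>\<^sub>M s\<in>V. unif01)"
  by (intro prob_space_PiM prob_space_unif01)

lemma arc_prod_integrable:
  assumes "unit_kernel U" "A \<subseteq> V \<times> V"
  shows "integrable (\<Pi>\<^sub>M s\<in>V. unif01) (arc_prod A U)"
proof -
  interpret prob_space "\<Pi>\<^sub>M s\<in>V. unif01" by (rule prob_space_PiM_unif01)
  show ?thesis
    by (rule integrable_const_bound[of _ 1])
       (use arc_prod_unit_space[OF assms] arc_prod_measurable[OF assms] in auto)
qed

lemma hom_density_unit:
  assumes "unit_kernel U" "parcs H \<subseteq> pverts H \<times> pverts H"
  shows "hom_density H U \<in> {0..1}"
proof -
  interpret prob_space "\<Pi>\<^sub>M s\<in>pverts H. unif01" by (rule prob_space_PiM_unif01)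
  note b = arc_prod_unit_space[OF assms]
  have "hom_density H U \<le> (\<integral>x. 1 \<partial>(\<Pi>\<^sub>M s\<in>pverts H. unif01))"
    unfolding hom_density_arc_prod
    by (intro integral_mono arc_prod_integrable assms) (use b in auto)
  moreover have "hom_density H U \<ge> 0"
    unfolding hom_density_arc_prod by (intro Bochner_Integration.integral_nonneg) (use b in auto)
  ultimately show ?thesis by (simp add: prob_space)
qed

definition map_digraph :: "('v \<Rightarrow> 'w) \<Rightarrow> 'v pair_pre_digraph \<Rightarrow> 'w pair_pre_digraph" where
  "map_digraph f H = \<lparr> pverts = f ` pverts H, parcs = map_prod f f ` parcs H \<rparr>"

lemma oriented_map_digraph:
  assumes "oriented_graph H" "inj_on f (pverts H)"
  shows "oriented_graph (map_digraph f H)"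
proof -
  note H = oriented_graphD[OF assms(1)]
  have "(b, a) \<notin> map_prod f f ` parcs H" if ab: "(a, b) \<in> map_prod f f ` parcs H" for a b
  proof
    assume "(b, a) \<in> map_prod f f ` parcs H"
    with ab obtain u v u' v' where *: "(u, v) \<in> parcs H" "(v', u') \<in> parcs H"
        "f v' = f v" "f u' = f u" by auto
    with H(2) have "v' = v" "u' = u" by (auto intro: inj_onD[OF assms(2)])
    with * H(4) show False by auto
  qed
  moreover have "map_prod f f ` parcs H \<subseteq> f ` pverts H \<times> f ` pverts H" using H(2) by auto
  ultimately show ?thesis
    using H(1) by (simp add: oriented_graph_def map_digraph_def)
qed

lemma arc_prod_map:
  assumes "A \<subseteq> V \<times> V" "inj_on f V"
  shows "arc_prod (map_prod f f ` A) U x = arc_prod A U (\<lambda>s. x (f s))"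
proof -
  have "inj_on (map_prod f f) A"
    using inj_on_subset[OF map_prod_inj_on[OF assms(2) assms(2)] assms(1)] .
  then show ?thesis
    unfolding arc_prod_def by (subst prod.reindex) (auto intro!: prod.cong)
qed

text \<open>An embedded copy of a graph has the same density because the coordinates of the product measure
are exchangeable. This lets a fixed graph be placed on any injective choice of vertices of the
random tournament.\<close>

lemma hom_density_map:
  assumes "unit_kernel U" "parcs H \<subseteq> pverts H \<times> pverts H" "inj_on f (pverts H)"
  shows "hom_density (map_digraph f H) U = hom_density H U"
proof -
  let ?V = "pverts H"
  let ?t = "\<lambda>\<omega>. \<lambda>s\<in>?V. \<omega> (f s)"
  have d: "distr (\<Pi>\<^sub>M i\<in>f ` ?V. unif01) (\<Pi>\<^sub>M i\<in>?V. unif01) ?t = (\<Pi>\<^sub>M i\<in>?V. unif01)"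
    by (rule distr_PiM_reindex[where K = "f ` ?V" and M = "\<lambda>_. unif01"])
       (use assms prob_space_unif01 in auto)
  have t: "?t \<in> (\<Pi>\<^sub>M i\<in>f ` ?V. unif01) \<rightarrow>\<^sub>M (\<Pi>\<^sub>M i\<in>?V. unif01)"
    by (intro measurable_restrict measurable_component_singleton) auto
  have "hom_density (map_digraph f H) U
      = (\<integral>x. arc_prod (parcs H) U (\<lambda>s. x (f s)) \<partial>(\<Pi>\<^sub>M s\<in>f ` ?V. unif01))"
    by (simp add: hom_density_arc_prod map_digraph_def arc_prod_map[OF assms(2,3)])
  also have "\<dots> = (\<integral>x. arc_prod (parcs H) U (?t x) \<partial>(\<Pi>\<^sub>M s\<in>f ` ?V. unif01))"
    using assms(2) by (intro Bochner_Integration.integral_cong refl)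
      (auto simp: arc_prod_def intro!: prod.cong)
  also have "\<dots> = (\<integral>x. arc_prod (parcs H) U x
       \<partial>(distr (\<Pi>\<^sub>M i\<in>f ` ?V. unif01) (\<Pi>\<^sub>M i\<in>?V. unif01) ?t))"
    by (rule integral_distr[OF t arc_prod_measurable[OF assms(1,2)], symmetric])
  finally show ?thesis by (simp only: d hom_density_arc_prod)
qed

text \<open>Two disjoint copies of a graph. Its density is a square, so the second moment of a density is
again the first moment of a density.\<close>

definition double_digraph :: "'v pair_pre_digraph \<Rightarrow> ('v + 'v) pair_pre_digraph" where
  "double_digraph H = \<lparr> pverts = pverts H <+> pverts H,
     parcs = map_prod Inl Inl ` parcs H \<union> map_prod Inr Inr ` parcs H \<rparr>"

lemma oriented_double_digraph:
  "oriented_graph H \<Longrightarrow> oriented_graph (double_digraph H)"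
  unfolding oriented_graph_def double_digraph_def by auto

lemma hom_density_double:
  assumes U: "unit_kernel U" and H: "oriented_graph H"
  shows "hom_density (double_digraph H) U = (hom_density H U)\<^sup>2"
proof -
  interpret product_sigma_finite "\<lambda>_::'a + 'a. unif01"
    using prob_space_unif01 by (intro product_sigma_finite.intro prob_space_imp_sigma_finite)
  let ?H1 = "map_digraph Inl H :: ('a + 'a) pair_pre_digraph"
    and ?H2 = "map_digraph Inr H :: ('a + 'a) pair_pre_digraph"
  let ?V1 = "pverts ?H1" and ?V2 = "pverts ?H2"
  let ?D = "double_digraph H"
  note Hd = oriented_graphD[OF H]
  note D = oriented_graphD[OF oriented_double_digraph[OF H]]
  have V: "pverts ?D = ?V1 \<union> ?V2" and A: "parcs ?D = parcs ?H1 \<union> parcs ?H2"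
    by (auto simp: double_digraph_def map_digraph_def)
  have disj: "?V1 \<inter> ?V2 = {}" and fin: "finite ?V1" "finite ?V2"
    using Hd(1) by (auto simp: map_digraph_def)
  have dA: "parcs ?H1 \<inter> parcs ?H2 = {}" and fA: "finite (parcs ?H1)" "finite (parcs ?H2)"
    and A1: "parcs ?H1 \<subseteq> ?V1 \<times> ?V1" and A2: "parcs ?H2 \<subseteq> ?V2 \<times> ?V2"
    using Hd(2,3) by (auto simp: map_digraph_def)
  \<comment> \<open>No arc joins the two copies, so the integrand is a product of functions of disjoint coordinates.\<close>
  have split: "arc_prod (parcs ?D) U (merge ?V1 ?V2 (x, y))
      = arc_prod (parcs ?H1) U x * arc_prod (parcs ?H2) U y" for x y
  proof -
    have "arc_prod (parcs ?D) U (merge ?V1 ?V2 (x, y))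
      = arc_prod (parcs ?H1) U (merge ?V1 ?V2 (x, y)) * arc_prod (parcs ?H2) U (merge ?V1 ?V2 (x, y))"
      unfolding A arc_prod_def by (rule prod.union_disjoint[OF fA dA])
    also have "arc_prod (parcs ?H1) U (merge ?V1 ?V2 (x, y)) = arc_prod (parcs ?H1) U x"
      unfolding arc_prod_def using A1 by (intro prod.cong) (auto simp: merge_def)
    also have "arc_prod (parcs ?H2) U (merge ?V1 ?V2 (x, y)) = arc_prod (parcs ?H2) U y"
      unfolding arc_prod_def using A2 disj by (intro prod.cong) (auto simp: merge_def)
    finally show ?thesis .
  qed
  have "hom_density ?D U = (\<integral>x. \<integral>y. arc_prod (parcs ?D) U (merge ?V1 ?V2 (x, y))
      \<partial>(\<Pi>\<^sub>M s\<in>?V2. unif01) \<partial>(\<Pi>\<^sub>M s\<in>?V1. unif01))"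
    unfolding hom_density_arc_prod V
    by (rule product_integral_fold[OF disj fin])
       (use arc_prod_integrable[OF U D(2)] in \<open>simp add: V\<close>)
  also have "\<dots> = hom_density ?H1 U * hom_density ?H2 U"
    unfolding split by (simp add: hom_density_arc_prod)
  also have "\<dots> = (hom_density H U)\<^sup>2"
    using hom_density_map[OF U Hd(2), of "Inl :: 'a \<Rightarrow> 'a + 'a"]
      hom_density_map[OF U Hd(2), of "Inr :: 'a \<Rightarrow> 'a + 'a"]
    by (simp add: power2_eq_square)
  finally show ?thesis .
qed

section \<open>The limiting variance as the variance of the triangle density\<close>

text \<open>The iterated integrals are evaluated in \<open>ennreal\<close>, where Tonelli's theorem asks only for measurability.\<close>

lemma ennreal_hom_density:
  assumes "unit_kernel U" "parcs H \<subseteq> pverts H \<times> pverts H"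
  shows "ennreal (hom_density H U)
    = (\<integral>\<^sup>+x. ennreal (arc_prod (parcs H) U x) \<partial>(\<Pi>\<^sub>M s\<in>pverts H. unif01))"
  unfolding hom_density_arc_prod
  by (rule nn_integral_eq_integral[symmetric, OF arc_prod_integrable[OF assms]])
     (use arc_prod_unit_space[OF assms] in auto)

lemma
  assumes U: "unit_kernel U" and x: "x \<in> space unif01"
  shows ennreal_tri_density: "ennreal (tri_density U x)
      = (\<integral>\<^sup>+y. \<integral>\<^sup>+z. ennreal (U x y * U y z * U z x) \<partial>unif01 \<partial>unif01)"
    and tri_density_unit: "tri_density U x \<in> {0..1}"
proof -
  interpret u: prob_space unif01 by (rule prob_space_unif01)
  interpret p: pair_prob_space unif01 unif01 by unfold_locales
  note [measurable (raw)] = unit_kernel_measurable[OF U]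
  have b: "U a b * U b c * U c a \<in> {0..1}"
    if "a \<in> space unif01" "b \<in> space unif01" "c \<in> space unif01" for a b c
  proof -
    have "U a b \<in> {0..1}" "U b c \<in> {0..1}" "U c a \<in> {0..1}"
      using that U by (auto simp: unit_kernel_def space_unif01)
    then show ?thesis by (auto intro!: mult_le_one)
  qed
  have m: "(\<lambda>(y, z). U x y * U y z * U z x) \<in> borel_measurable (unif01 \<Otimes>\<^sub>M unif01)"
    using x by measurable
  have i: "integrable (unif01 \<Otimes>\<^sub>M unif01) (\<lambda>(y, z). U x y * U y z * U z x)"
    by (rule p.P.integrable_const_bound[of _ 1])
       (use b[OF x] m in \<open>auto simp: space_pair_measure intro!: AE_I2\<close>)
  have nn: "0 \<le> tri_density U x"
    unfolding tri_density_def using b[OF x]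
    by (intro Bochner_Integration.integral_nonneg) (auto simp: space_pair_measure)
  have "tri_density U x \<le> (\<integral>_. 1 \<partial>(unif01 \<Otimes>\<^sub>M unif01))"
    unfolding tri_density_def using b[OF x] i
    by (intro integral_mono) (auto simp: space_pair_measure)
  with nn show "tri_density U x \<in> {0..1}" by (simp add: p.P.prob_space)
  have "ennreal (tri_density U x)
      = (\<integral>\<^sup>+p. ennreal ((\<lambda>(y, z). U x y * U y z * U z x) p) \<partial>(unif01 \<Otimes>\<^sub>M unif01))"
    unfolding tri_density_def
    by (rule nn_integral_eq_integral[symmetric, OF i])
       (use b[OF x] in \<open>auto simp: space_pair_measure intro!: AE_I2\<close>)
  also have "\<dots> = (\<integral>\<^sup>+y. \<integral>\<^sup>+z. ennreal (U x y * U y z * U z x) \<partial>unif01 \<partial>unif01)"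
    using m by (subst u.nn_integral_fst[symmetric]) auto
  finally show "ennreal (tri_density U x) = \<dots>" .
qed

lemma tri_density_measurable:
  assumes U: "unit_kernel U"
  shows "tri_density U \<in> borel_measurable unif01"
proof -
  interpret u: prob_space unif01 by (rule prob_space_unif01)
  interpret p: pair_prob_space unif01 unif01 by unfold_locales
  note [measurable (raw)] = unit_kernel_measurable[OF U]
  show ?thesis
    unfolding tri_density_def by (intro p.P.borel_measurable_lebesgue_integral) measurable
qed

lemma tri_density_integrable:
  assumes U: "unit_kernel U"
  shows "integrable unif01 (tri_density U)" "integrable unif01 (\<lambda>x. (tri_density U x)\<^sup>2)"
proof -
  interpret u: prob_space unif01 by (rule prob_space_unif01)
  note [measurable] = tri_density_measurable[OF U]
  note t = tri_density_unit[OF U]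
  show "integrable unif01 (tri_density U)"
    by (rule u.integrable_const_bound[of _ 1]) (use t in auto)
  show "integrable unif01 (\<lambda>x. (tri_density U x)\<^sup>2)"
    by (rule u.integrable_const_bound[of _ 1]) (use t in \<open>auto simp: power_le_one\<close>)
qed

lemma nn_integral_PiM_two:
  fixes a b :: 'v and M :: "'b measure"
  assumes M: "sigma_finite_measure M" and ab: "a \<noteq> b"
    and f: "f \<in> borel_measurable (\<Pi>\<^sub>M s\<in>{a, b}. M)"
  shows "(\<integral>\<^sup>+p. f p \<partial>(\<Pi>\<^sub>M s\<in>{a, b}. M))
    = (\<integral>\<^sup>+y. \<integral>\<^sup>+z. f ((\<lambda>_. undefined)(b := z, a := y)) \<partial>M \<partial>M)"
proof -
  interpret product_sigma_finite "\<lambda>_::'v. M"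
    using M by (intro product_sigma_finite.intro)
  have "(\<integral>\<^sup>+p. f p \<partial>(\<Pi>\<^sub>M s\<in>{a, b}. M))
      = (\<integral>\<^sup>+y. \<integral>\<^sup>+p. f (p(a := y)) \<partial>(\<Pi>\<^sub>M s\<in>{b}. M) \<partial>M)"
    by (rule product_nn_integral_insert_rev) (use ab f in auto)
  also have "\<dots> = (\<integral>\<^sup>+y. \<integral>\<^sup>+z. f ((\<lambda>_. undefined)(b := z, a := y)) \<partial>M \<partial>M)"
  proof (rule nn_integral_cong)
    fix y assume y: "y \<in> space M"
    have m: "(\<lambda>p. f (p(a := y))) \<in> borel_measurable (\<Pi>\<^sub>M s\<in>{b}. M)"
      by (rule measurable_compose[OF measurable_fun_upd f]) (use y in auto)
    have "(\<integral>\<^sup>+p. f (p(a := y)) \<partial>(\<Pi>\<^sub>M s\<in>{b}. M))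
        = (\<integral>\<^sup>+z. \<integral>\<^sup>+p. f (p(b := z, a := y)) \<partial>(\<Pi>\<^sub>M s\<in>{}. M) \<partial>M)"
      using product_nn_integral_insert_rev[of "{}" b, OF _ _ m] by simp
    also have "\<dots> = (\<integral>\<^sup>+z. f ((\<lambda>_. undefined)(b := z, a := y)) \<partial>M)"
      by (simp add: nn_integral_empty)
    finally show "(\<integral>\<^sup>+p. f (p(a := y)) \<partial>(\<Pi>\<^sub>M s\<in>{b}. M)) = \<dots>" .
  qed
  finally show ?thesis .
qed

lemma hom_density_C3:
  assumes U: "unit_kernel U"
  shows "hom_density C3 U = (\<integral>x. tri_density U x \<partial>unif01)"
proof -
  interpret u: prob_space unif01 by (rule prob_space_unif01)
  interpret product_sigma_finite "\<lambda>_::nat. unif01"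
    using prob_space_unif01 by (intro product_sigma_finite.intro prob_space_imp_sigma_finite)
  let ?A = "parcs C3"
  have wf: "parcs C3 \<subseteq> pverts C3 \<times> pverts C3" by (auto simp: C3_def)
  have m: "(\<lambda>x. ennreal (arc_prod ?A U x)) \<in> borel_measurable (\<Pi>\<^sub>M s\<in>insert 0 {1, 2}. unif01)"
    using arc_prod_measurable[OF U wf] by (simp add: C3_def)
  have "ennreal (hom_density C3 U)
      = (\<integral>\<^sup>+x. ennreal (arc_prod ?A U x) \<partial>(\<Pi>\<^sub>M s\<in>insert 0 {1, 2}. unif01))"
    unfolding ennreal_hom_density[OF U wf] by (simp add: C3_def)
  also have "\<dots> = (\<integral>\<^sup>+x. \<integral>\<^sup>+p. ennreal (arc_prod ?A U (p(0 := x)))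
      \<partial>(\<Pi>\<^sub>M s\<in>{1, 2}. unif01) \<partial>unif01)"
    by (rule product_nn_integral_insert_rev[OF _ _ m]) auto
  also have "\<dots> = (\<integral>\<^sup>+x. ennreal (tri_density U x) \<partial>unif01)"
  proof (rule nn_integral_cong)
    fix x assume x: "x \<in> space unif01"
    have m': "(\<lambda>p. ennreal (arc_prod ?A U (p(0 := x)))) \<in> borel_measurable (\<Pi>\<^sub>M s\<in>{1, 2}. unif01)"
      by (rule measurable_compose[OF measurable_fun_upd m]) (use x in auto)
    show "(\<integral>\<^sup>+p. ennreal (arc_prod ?A U (p(0 := x))) \<partial>(\<Pi>\<^sub>M s\<in>{1, 2}. unif01))
        = ennreal (tri_density U x)"
      unfolding ennreal_tri_density[OF U x]
      by (subst nn_integral_PiM_two[OF _ _ m'])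
         (auto simp: arc_prod_def C3_def ac_simps u.sigma_finite_measure_axioms)
  qed
  also have "\<dots> = ennreal (\<integral>x. tri_density U x \<partial>unif01)"
    by (rule nn_integral_eq_integral[OF tri_density_integrable(1)[OF U]])
       (use tri_density_unit[OF U] in auto)
  finally show ?thesis
    using hom_density_unit[OF U wf] tri_density_unit[OF U]
    by (subst (asm) ennreal_inj) (auto intro!: Bochner_Integration.integral_nonneg)
qed

text \<open>Fixing the common vertex $x$ of the two cycles makes the other four coordinates split into two
independent pairs, each of which integrates to the triangle density at $x$.\<close>

lemma hom_density_bowtie:
  assumes U: "unit_kernel U"
  shows "hom_density bowtie U = (\<integral>x. (tri_density U x)\<^sup>2 \<partial>unif01)"
proof -
  interpret u: prob_space unif01 by (rule prob_space_unif01)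
  interpret product_sigma_finite "\<lambda>_::nat. unif01"
    using prob_space_unif01 by (intro product_sigma_finite.intro prob_space_imp_sigma_finite)
  let ?A = "parcs bowtie"
  let ?P = "\<Pi>\<^sub>M s\<in>{1, 2::nat}. unif01" and ?Q = "\<Pi>\<^sub>M s\<in>{3, 4::nat}. unif01"
  let ?g = "\<lambda>x a b (p :: nat \<Rightarrow> real). U x (p a) * U (p a) (p b) * U (p b) x"
  have wf: "parcs bowtie \<subseteq> pverts bowtie \<times> pverts bowtie" by (auto simp: bowtie_def)
  have pv: "pverts bowtie = insert 0 ({1, 2} \<union> {3, 4})" by (auto simp: bowtie_def)
  have m: "(\<lambda>x. ennreal (arc_prod ?A U x))
      \<in> borel_measurable (\<Pi>\<^sub>M s\<in>insert 0 ({1, 2} \<union> {3, 4}). unif01)"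
    using arc_prod_measurable[OF U wf] unfolding pv by simp
  note [measurable (raw)] = unit_kernel_measurable[OF U]
  have g: "(\<integral>\<^sup>+p. ennreal (?g x a b p) \<partial>(\<Pi>\<^sub>M s\<in>{a, b}. unif01)) = ennreal (tri_density U x)"
    and gm: "(\<lambda>p. ennreal (?g x a b p)) \<in> borel_measurable (\<Pi>\<^sub>M s\<in>{a, b}. unif01)"
    and gn: "p \<in> space (\<Pi>\<^sub>M s\<in>{a, b}. unif01) \<Longrightarrow> ?g x a b p \<ge> 0"
    if x: "x \<in> space unif01" and ab: "a \<noteq> b" for x a b p
  proof -
    have [measurable]: "(\<lambda>p. p a) \<in> (\<Pi>\<^sub>M s\<in>{a, b}. unif01) \<rightarrow>\<^sub>M unif01"
      "(\<lambda>p. p b) \<in> (\<Pi>\<^sub>M s\<in>{a, b}. unif01) \<rightarrow>\<^sub>M unif01"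
      by (auto intro!: measurable_component_singleton)
    show gm: "(\<lambda>p. ennreal (?g x a b p)) \<in> borel_measurable (\<Pi>\<^sub>M s\<in>{a, b}. unif01)"
      using x by measurable
    show "(\<integral>\<^sup>+p. ennreal (?g x a b p) \<partial>(\<Pi>\<^sub>M s\<in>{a, b}. unif01)) = ennreal (tri_density U x)"
      unfolding ennreal_tri_density[OF U x]
      by (subst nn_integral_PiM_two[OF _ ab gm]) (use ab in \<open>auto simp: u.sigma_finite_measure_axioms\<close>)
    show "?g x a b p \<ge> 0" if "p \<in> space (\<Pi>\<^sub>M s\<in>{a, b}. unif01)"
    proof -
      have "p a \<in> {0..1}" "p b \<in> {0..1}" "x \<in> {0..1}"
        using that x by (auto simp: space_PiM space_unif01 PiE_iff)
      then have "U x (p a) \<ge> 0" "U (p a) (p b) \<ge> 0" "U (p b) x \<ge> 0"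
        using U by (auto simp: unit_kernel_def)
      then show ?thesis by simp
    qed
  qed
  have "ennreal (hom_density bowtie U)
      = (\<integral>\<^sup>+x. ennreal (arc_prod ?A U x) \<partial>(\<Pi>\<^sub>M s\<in>insert 0 ({1, 2} \<union> {3, 4}). unif01))"
    unfolding ennreal_hom_density[OF U wf] pv ..
  also have "\<dots> = (\<integral>\<^sup>+x. \<integral>\<^sup>+p. ennreal (arc_prod ?A U (p(0 := x)))
      \<partial>(\<Pi>\<^sub>M s\<in>{1, 2} \<union> {3, 4}. unif01) \<partial>unif01)"
    by (rule product_nn_integral_insert_rev[OF _ _ m]) auto
  also have "\<dots> = (\<integral>\<^sup>+x. ennreal ((tri_density U x)\<^sup>2) \<partial>unif01)"
  proof (rule nn_integral_cong)
    fix x assume x: "x \<in> space unif01"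
    have m': "(\<lambda>p. ennreal (arc_prod ?A U (p(0 := x))))
        \<in> borel_measurable (\<Pi>\<^sub>M s\<in>{1, 2} \<union> {3, 4}. unif01)"
      by (rule measurable_compose[OF measurable_fun_upd m]) (use x in auto)
    have s: "arc_prod ?A U ((merge {1, 2} {3, 4} (p, q))(0 := x)) = ?g x 1 2 p * ?g x 3 4 q" for p q
      by (simp add: arc_prod_def bowtie_def merge_def mult_ac)
    have "(\<integral>\<^sup>+p. ennreal (arc_prod ?A U (p(0 := x))) \<partial>(\<Pi>\<^sub>M s\<in>{1, 2} \<union> {3, 4}. unif01))
        = (\<integral>\<^sup>+p. \<integral>\<^sup>+q. ennreal (?g x 1 2 p * ?g x 3 4 q) \<partial>?Q \<partial>?P)"
      unfolding s[symmetric] by (rule product_nn_integral_fold[OF _ _ _ m']) auto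
    also have "\<dots> = (\<integral>\<^sup>+p. \<integral>\<^sup>+q. ennreal (?g x 1 2 p) * ennreal (?g x 3 4 q) \<partial>?Q \<partial>?P)"
      by (intro nn_integral_cong ennreal_mult gn x) auto
    also have "\<dots> = (\<integral>\<^sup>+p. ennreal (?g x 1 2 p) * ennreal (tri_density U x) \<partial>?P)"
      by (intro nn_integral_cong, subst nn_integral_cmult) (use gm[OF x, of 3 4] g[OF x, of 3 4] in auto)
    also have "\<dots> = ennreal (tri_density U x) * ennreal (tri_density U x)"
      by (subst nn_integral_multc) (use gm[OF x, of 1 2] g[OF x, of 1 2] in auto)
    also have "\<dots> = ennreal ((tri_density U x)\<^sup>2)"
      using tri_density_unit[OF U x] by (simp add: ennreal_mult power2_eq_square)
    finally show "(\<integral>\<^sup>+p. ennreal (arc_prod ?A U (p(0 := x)))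
        \<partial>(\<Pi>\<^sub>M s\<in>{1, 2} \<union> {3, 4}. unif01)) = \<dots>" .
  qed
  also have "\<dots> = ennreal (\<integral>x. (tri_density U x)\<^sup>2 \<partial>unif01)"
    by (rule nn_integral_eq_integral[OF tri_density_integrable(2)[OF U]]) auto
  finally show ?thesis
    using hom_density_unit[OF U wf]
    by (subst (asm) ennreal_inj) (auto intro!: Bochner_Integration.integral_nonneg)
qed

lemma sigma2_variance:
  assumes U: "unit_kernel U"
  shows "sigma2 U = (\<integral>x. (tri_density U x - hom_density C3 U)\<^sup>2 \<partial>unif01)"
    and "integrable unif01 (\<lambda>x. (tri_density U x - hom_density C3 U)\<^sup>2)"
proof -
  interpret u: prob_space unif01 by (rule prob_space_unif01)
  note i = tri_density_integrable[OF U]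
  show "sigma2 U = (\<integral>x. (tri_density U x - hom_density C3 U)\<^sup>2 \<partial>unif01)"
    unfolding sigma2_def hom_density_bowtie[OF U] hom_density_C3[OF U]
    by (rule u.variance_eq[symmetric, OF i])
  show "integrable unif01 (\<lambda>x. (tri_density U x - hom_density C3 U)\<^sup>2)"
    unfolding power2_diff using i by auto
qed

lemma sigma2_nonneg: "unit_kernel U \<Longrightarrow> sigma2 U \<ge> 0"
  by (simp add: sigma2_variance(1))

text \<open>A variance vanishes exactly when the variable is almost surely equal to its mean.\<close>

lemma sigma2_eq_0_iff_tri_regular:
  assumes U: "unit_kernel U"
  shows "sigma2 U = 0 \<longleftrightarrow> tri_regular U"
proof -
  interpret u: prob_space unif01 by (rule prob_space_unif01)
  have "sigma2 U = 0 \<longleftrightarrow> (AE x in unif01. tri_density U x = hom_density C3 U)"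
    unfolding sigma2_variance(1)[OF U]
    by (subst integral_nonneg_eq_0_iff_AE[OF sigma2_variance(2)[OF U]]) auto
  also have "\<dots> \<longleftrightarrow> tri_regular U"
  proof
    assume "tri_regular U"
    then obtain c where c: "AE x in unif01. tri_density U x = c" by (auto simp: tri_regular_def)
    have "hom_density C3 U = (\<integral>x. c \<partial>unif01)"
      unfolding hom_density_C3[OF U]
      by (rule integral_cong_AE) (use c tri_density_measurable[OF U] in auto)
    with c show "AE x in unif01. tri_density U x = hom_density C3 U"
      by (simp add: u.prob_space)
  qed (auto simp: tri_regular_def)
  finally show ?thesis .
qed

section \<open>Expectations over the random tournament\<close>

definition up_pairs :: "nat \<Rightarrow> (nat \<times> nat) set" where
  "up_pairs n = {(u, v). 1 \<le> u \<and> u < v \<and> v \<le> n}"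

lemma finite_up_pairs: "finite (up_pairs n)"
  unfolding up_pairs_def by (rule finite_subset[of _ "{1..n} \<times> {1..n}"]) auto

text \<open>The contribution of the pair $p = (u, v)$, $u < v$, to the product over the arcs in $A$, as a
function of the single value $z$ at $(u, v)$: the reversed arc contributes $1 - z$.\<close>

definition orient :: "(nat \<times> nat) set \<Rightarrow> nat \<times> nat \<Rightarrow> real \<Rightarrow> real" where
  "orient A p z = (if p \<in> A then z else 1) * (if prod.swap p \<in> A then 1 - z else 1)"

text \<open>Regrouping a product over arcs by unordered pairs. It applies to the adjacency matrix, where the
factors become independent, and to the tournamenton, because both satisfy $Z(v,u) = 1 - Z(u,v)$.\<close>

lemma arc_prod_up_pairs:
  fixes Z :: "nat \<Rightarrow> nat \<Rightarrow> real"
  assumes A: "A \<subseteq> {1..n} \<times> {1..n}" "\<And>u. (u, u) \<notin> A"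
    and Z: "\<And>u v. 1 \<le> u \<Longrightarrow> u < v \<Longrightarrow> v \<le> n \<Longrightarrow> Z v u = 1 - Z u v"
  shows "(\<Prod>(u, v)\<in>A. Z u v) = (\<Prod>(u, v)\<in>up_pairs n. orient A (u, v) (Z u v))"
proof -
  let ?P = "up_pairs n"
  let ?D = "{p \<in> ?P. prod.swap p \<in> A}"
  have fin: "finite A" using A(1) finite_subset by blast
  have "A = (A \<inter> ?P) \<union> prod.swap ` ?D"
  proof (intro equalityI subsetI)
    fix p assume p: "p \<in> A"
    obtain u v where uv: "p = (u, v)" by (cases p)
    with p A have "u \<noteq> v" "u \<in> {1..n}" "v \<in> {1..n}" by auto
    then consider "(u, v) \<in> ?P" | "(v, u) \<in> ?P" by (fastforce simp: up_pairs_def)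
    then show "p \<in> (A \<inter> ?P) \<union> prod.swap ` ?D"
    proof cases
      case 2
      then have "prod.swap (v, u) \<in> prod.swap ` ?D" using p uv by (intro imageI) auto
      then show ?thesis using uv by simp
    qed (use p uv in auto)
  qed auto
  moreover have "(A \<inter> ?P) \<inter> prod.swap ` ?D = {}"
    by (auto simp: up_pairs_def)
  ultimately have "(\<Prod>(u, v)\<in>A. Z u v)
      = (\<Prod>(u, v)\<in>A \<inter> ?P. Z u v) * (\<Prod>(u, v)\<in>prod.swap ` ?D. Z u v)"
    using fin finite_up_pairs[of n] by (metis (lifting) prod.union_disjoint finite_Un)
  also have "(\<Prod>(u, v)\<in>A \<inter> ?P. Z u v) = (\<Prod>p\<in>?P. if p \<in> A then (case p of (u, v) \<Rightarrow> Z u v) else 1)"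
    by (subst prod.inter_restrict[OF finite_up_pairs, symmetric]) (simp add: Int_commute)
  also have "(\<Prod>(u, v)\<in>prod.swap ` ?D. Z u v) = (\<Prod>(u, v)\<in>?D. Z v u)"
    by (subst prod.reindex) (auto simp: case_prod_beta inj_on_def)
  also have "\<dots> = (\<Prod>(u, v)\<in>?D. 1 - Z u v)"
    by (intro prod.cong refl) (auto simp: up_pairs_def Z)
  also have "\<dots> = (\<Prod>p\<in>?P. if prod.swap p \<in> A then (case p of (u, v) \<Rightarrow> 1 - Z u v) else 1)"
    by (rule prod.inter_filter[OF finite_up_pairs])
  also have "(\<Prod>p\<in>?P. if p \<in> A then (case p of (u, v) \<Rightarrow> Z u v) else 1) * \<dots>
      = (\<Prod>(u, v)\<in>?P. orient A (u, v) (Z u v))"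
    unfolding prod.distrib[symmetric]
    by (intro prod.cong refl) (auto simp: orient_def)
  finally show ?thesis .
qed

lemma bernoulli_orient:
  assumes "q \<in> {0..1}" "(u, v) \<in> A \<Longrightarrow> (v, u) \<notin> A"
  shows "measure_pmf.expectation (bernoulli_pmf q) (\<lambda>b. orient A (u, v) (of_bool b))
      = orient A (u, v) q"
  using assms by (auto simp: orient_def integral_bernoulli_pmf)

text \<open>Each factor \<open>orient A p\<close> is affine in its argument, since no pair occurs in both directions.
Hence the expectation passes through it and replaces the edge indicator by its success probability.\<close>

lemma expectation_cond_tournament:
  assumes W: "tournamenton W" and A: "A \<subseteq> {1..n} \<times> {1..n}"
    and o: "\<And>u v. (u, v) \<in> A \<Longrightarrow> (v, u) \<notin> A"
    and \<eta>: "\<And>u. u \<in> {1..n} \<Longrightarrow> \<eta> u \<in> {0..1}"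
  shows "measure_pmf.expectation (cond_tournament n W \<eta>) (\<lambda>a. arc_prod A a (\<lambda>s. s))
      = arc_prod A W \<eta>"
proof -
  let ?P = "up_pairs n"
  let ?p = "\<lambda>(u, v). bernoulli_pmf (W (\<eta> u) (\<eta> v))"
  have loop: "(u, u) \<notin> A" for u using o[of u u] by auto
  have W01: "W (\<eta> u) (\<eta> v) \<in> {0..1}" "W (\<eta> v) (\<eta> u) = 1 - W (\<eta> u) (\<eta> v)"
    if "1 \<le> u" "u < v" "v \<le> n" for u v
  proof -
    have "\<eta> u \<in> {0..1}" "\<eta> v \<in> {0..1}" using \<eta>[of u] \<eta>[of v] that by auto
    with W have "W (\<eta> u) (\<eta> v) \<in> {0..1}" "W (\<eta> u) (\<eta> v) + W (\<eta> v) (\<eta> u) = 1"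
      unfolding tournamenton_def by blast+
    then show "W (\<eta> u) (\<eta> v) \<in> {0..1}" "W (\<eta> v) (\<eta> u) = 1 - W (\<eta> u) (\<eta> v)" by auto
  qed
  have adj: "arc_prod A (adj_matrix n e) (\<lambda>s. s) = (\<Prod>p\<in>?P. orient A p (of_bool (e p)))" for e
  proof -
    have "arc_prod A (adj_matrix n e) (\<lambda>s. s)
        = (\<Prod>(u, v)\<in>?P. orient A (u, v) (adj_matrix n e u v))"
      unfolding arc_prod_def
      by (rule arc_prod_up_pairs[OF A loop]) (auto simp: adj_matrix_def)
    also have "\<dots> = (\<Prod>p\<in>?P. orient A p (of_bool (e p)))"
      by (intro prod.cong refl) (auto simp: up_pairs_def adj_matrix_def)
    finally show ?thesis .
  qed
  have "measure_pmf.expectation (cond_tournament n W \<eta>) (\<lambda>a. arc_prod A a (\<lambda>s. s))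
      = measure_pmf.expectation (Pi_pmf ?P False ?p) (\<lambda>e. \<Prod>p\<in>?P. orient A p (of_bool (e p)))"
    by (simp add: cond_tournament_def adj up_pairs_def)
  also have "\<dots> = (\<Prod>p\<in>?P. measure_pmf.expectation (?p p) (\<lambda>b. orient A p (of_bool b)))"
    by (rule expectation_prod_Pi_pmf[OF finite_up_pairs])
       (auto simp: orient_def intro!: integrable_measure_pmf_finite)
  also have "\<dots> = (\<Prod>(u, v)\<in>?P. orient A (u, v) (W (\<eta> u) (\<eta> v)))"
  proof (rule prod.cong[OF refl])
    fix p assume "p \<in> ?P"
    then obtain u v where uv: "p = (u, v)" "1 \<le> u" "u < v" "v \<le> n" by (auto simp: up_pairs_def)
    show "measure_pmf.expectation (?p p) (\<lambda>b. orient A p (of_bool b))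
        = (case p of (u, v) \<Rightarrow> orient A (u, v) (W (\<eta> u) (\<eta> v)))"
      using bernoulli_orient[OF W01(1)[OF uv(2-4)] o] uv(1) by simp
  qed
  also have "\<dots> = arc_prod A W \<eta>"
    unfolding arc_prod_def
    by (rule arc_prod_up_pairs[OF A loop, symmetric]) (use W01 in auto)
  finally show ?thesis .
qed

text \<open>All adjacency matrices that can occur. As there are finitely many, an expectation over the random
tournament is a finite sum, and it may be exchanged with any integral over $[0,1]^k$.\<close>

definition tournaments :: "nat \<Rightarrow> (nat \<Rightarrow> nat \<Rightarrow> real) set" where
  "tournaments n = adj_matrix n ` PiE_dflt (up_pairs n) False (\<lambda>_. UNIV)"

lemma finite_tournaments: "finite (tournaments n)"
  unfolding tournaments_def by (intro finite_imageI finite_PiE_dflt finite_up_pairs) auto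

lemma tournaments_unit: "a \<in> tournaments n \<Longrightarrow> a u v \<in> {0..1}"
  by (auto simp: tournaments_def adj_matrix_def)

lemma set_cond_tournament: "set_pmf (cond_tournament n W \<eta>) \<subseteq> tournaments n"
proof -
  have "set_pmf (cond_tournament n W \<eta>)
      = adj_matrix n ` set_pmf (Pi_pmf (up_pairs n) False (\<lambda>(u, v). bernoulli_pmf (W (\<eta> u) (\<eta> v))))"
    by (simp add: cond_tournament_def up_pairs_def)
  then show ?thesis
    unfolding tournaments_def
    using set_Pi_pmf_subset'[OF finite_up_pairs[of n], of False
        "\<lambda>(u, v). bernoulli_pmf (W (\<eta> u) (\<eta> v))"]
    by (auto simp: PiE_dflt_def)
qed

lemma cond_tournament_subprob:
  "tournamenton W \<Longrightarrow> (\<lambda>\<eta>. measure_pmf (cond_tournament n W \<eta>))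
    \<in> (\<Pi>\<^sub>M u\<in>{1..n}. unif01) \<rightarrow>\<^sub>M subprob_algebra (count_space UNIV)"
  by (rule measurable_prob_algebraD[OF cond_tournament_kernel])

lemma AE_tournaments:
  assumes "tournamenton W"
  shows "AE a in random_tournament n W. a \<in> tournaments n"
  unfolding random_tournament_def
  by (subst AE_bind[OF cond_tournament_subprob[OF assms]])
     (use set_cond_tournament in \<open>auto intro!: AE_I2 AE_pmfI\<close>)

lemma random_tournament_space:
  assumes "tournamenton W"
  shows "space (random_tournament n W) = UNIV"
    "f \<in> measurable (random_tournament n W) N \<longleftrightarrow> range f \<subseteq> space N"
proof -
  show s: "space (random_tournament n W) = UNIV"
    using prob_space_random_tournament(2)[OF assms] sets.sets_into_space sets_eq_imp_space_eq
    by (metis space_count_space sets_count_space Pow_UNIV)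
  show "f \<in> measurable (random_tournament n W) N \<longleftrightarrow> range f \<subseteq> space N"
    using s prob_space_random_tournament(2)[OF assms] by (auto simp: measurable_def)
qed

lemma random_tournament_integral:
  fixes f :: "(nat \<Rightarrow> nat \<Rightarrow> real) \<Rightarrow> real"
  assumes W: "tournamenton W"
  shows "integrable (random_tournament n W) f"
    and "(\<integral>a. f a \<partial>random_tournament n W)
      = (\<Sum>a\<in>tournaments n. measure (random_tournament n W) {a} * f a)"
proof -
  interpret prob_space "random_tournament n W" by (rule prob_space_random_tournament[OF W])
  have m: "g \<in> borel_measurable (random_tournament n W)" for g :: "(nat \<Rightarrow> nat \<Rightarrow> real) \<Rightarrow> real"
    by (simp add: random_tournament_space[OF W])
  show "integrable (random_tournament n W) f"
  proof (rule integrable_const_bound[OF _ m])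
    show "AE a in random_tournament n W. norm (f a) \<le> (\<Sum>a\<in>tournaments n. norm (f a))"
      using AE_tournaments[OF W]
      by (rule AE_mp) (auto intro!: AE_I2 member_le_sum finite_tournaments)
  qed
  have "(\<integral>a. f a \<partial>random_tournament n W)
      = (\<integral>a. (\<Sum>b\<in>tournaments n. f b * indicator {b} a) \<partial>random_tournament n W)"
  proof (rule integral_cong_AE[OF m m])
    show "AE a in random_tournament n W. f a = (\<Sum>b\<in>tournaments n. f b * indicator {b} a)"
      using AE_tournaments[OF W]
    proof (rule AE_mp, intro AE_I2 impI)
      fix a assume a: "a \<in> tournaments n"
      have "(\<Sum>b\<in>tournaments n. f b * indicator {b} a) = (\<Sum>b\<in>{a}. f b * indicator {b} a)"
        by (rule sum.mono_neutral_right) (use a finite_tournaments in auto)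
      then show "f a = (\<Sum>b\<in>tournaments n. f b * indicator {b} a)" by simp
    qed
  qed
  also have "\<dots> = (\<Sum>b\<in>tournaments n. f b * measure (random_tournament n W) {b})"
    using prob_space_random_tournament(2)[OF W, of n]
    by (subst Bochner_Integration.integral_sum)
       (auto simp: less_top[symmetric] intro!: integrable_real_indicator integrable_mult_right)
  finally show "(\<integral>a. f a \<partial>random_tournament n W)
      = (\<Sum>a\<in>tournaments n. measure (random_tournament n W) {a} * f a)"
    by (simp add: mult.commute)
qed

text \<open>A labelled copy of an oriented graph in the random tournament is exactly unbiased for the density
in $W$: average over the edges first, then over the vertex positions.\<close>

lemma expectation_arc_prod:
  assumes W: "tournamenton W" and G: "oriented_graph G" "pverts G \<subseteq> {1..n}"
  shows "(\<integral>a. arc_prod (parcs G) a (\<lambda>s. s) \<partial>random_tournament n W) = hom_density G W"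
proof -
  let ?A = "parcs G" and ?V = "pverts G"
  let ?R = "random_tournament n W" and ?N = "\<Pi>\<^sub>M u\<in>{1..n}. unif01"
  let ?f = "\<lambda>a. arc_prod ?A a (\<lambda>s. s)"
  interpret product_prob_space "\<lambda>_::nat. unif01" "{1..n}"
    using prob_space_unif01 by (intro product_prob_spaceI)
  note U = unit_kernel_tournamenton[OF W] and Gd = oriented_graphD[OF G(1)]
  have A: "?A \<subseteq> {1..n} \<times> {1..n}" using Gd(2) G(2) by auto
  have f01: "?f a \<in> {0..1}" if "a \<in> tournaments n" for a
    by (rule arc_prod_unit) (use tournaments_unit[OF that] in auto)
  have "ennreal (\<integral>a. ?f a \<partial>?R) = (\<integral>\<^sup>+a. ennreal (?f a) \<partial>?R)"
    by (rule nn_integral_eq_integral[symmetric, OF random_tournament_integral(1)[OF W]])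
       (use AE_tournaments[OF W, of n] f01 in \<open>auto elim!: AE_mp\<close>)
  also have "\<dots> = (\<integral>\<^sup>+\<eta>. \<integral>\<^sup>+a. ennreal (?f a) \<partial>measure_pmf (cond_tournament n W \<eta>) \<partial>?N)"
    unfolding random_tournament_def
    by (rule nn_integral_bind[OF _ cond_tournament_subprob[OF W]]) simp
  also have "\<dots> = (\<integral>\<^sup>+\<eta>. ennreal (arc_prod ?A W \<eta>) \<partial>?N)"
  proof (rule nn_integral_cong)
    fix \<eta> assume "\<eta> \<in> space ?N"
    then have \<eta>: "\<eta> u \<in> {0..1}" if "u \<in> {1..n}" for u
      using that by (auto simp: space_PiM space_unif01 PiE_iff)
    have "finite (set_pmf (cond_tournament n W \<eta>))"
      using finite_subset[OF set_cond_tournament finite_tournaments] .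
    then have "(\<integral>\<^sup>+a. ennreal (?f a) \<partial>measure_pmf (cond_tournament n W \<eta>))
        = ennreal (measure_pmf.expectation (cond_tournament n W \<eta>) ?f)"
      by (intro nn_integral_eq_integral integrable_measure_pmf_finite AE_pmfI)
         (use set_cond_tournament f01 in fastforce)+
    then show "(\<integral>\<^sup>+a. ennreal (?f a) \<partial>measure_pmf (cond_tournament n W \<eta>))
        = ennreal (arc_prod ?A W \<eta>)"
      using expectation_cond_tournament[OF W A Gd(4) \<eta>] by simp
  qed
  also have "\<dots> = (\<integral>\<^sup>+\<eta>. ennreal (arc_prod ?A W (restrict \<eta> ?V)) \<partial>?N)"
    using Gd(2) by (intro nn_integral_cong arg_cong[where f = ennreal])
      (auto simp: arc_prod_def intro!: prod.cong)
  also have "\<dots> = (\<integral>\<^sup>+\<eta>. ennreal (arc_prod ?A W \<eta>)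
      \<partial>distr ?N (\<Pi>\<^sub>M s\<in>?V. unif01) (\<lambda>x. restrict x ?V))"
    by (rule nn_integral_distr[OF measurable_restrict_subset[OF G(2)], symmetric])
       (use arc_prod_measurable[OF U Gd(2)] in simp)
  also have "\<dots> = ennreal (hom_density G W)"
    unfolding distr_PiM_restrict_finite[OF Gd(1) G(2)] ennreal_hom_density[OF U Gd(2)] ..
  finally show ?thesis
    using hom_density_unit[OF U Gd(2)] f01 AE_tournaments[OF W, of n]
    by (subst (asm) ennreal_inj) (auto intro!: integral_nonneg_AE elim!: AE_mp)
qed

section \<open>Empirical densities concentrate at the limiting densities\<close>

definition cell :: "nat \<Rightarrow> real \<Rightarrow> nat" where
  "cell n x = nat \<lceil>real n * x\<rceil>"

lemma cell_le: "x \<in> {0..1} \<Longrightarrow> cell n x \<le> n"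
  unfolding cell_def by (simp add: nat_le_iff ceiling_le_iff mult_left_le)

lemma cell_measurable: "cell n \<in> unif01 \<rightarrow>\<^sub>M count_space UNIV"
proof -
  have "cell n \<in> borel \<rightarrow>\<^sub>M count_space UNIV"
    unfolding cell_def by measurable
  then show ?thesis
    unfolding unif01_def by (intro measurable_restrict_space1) simp
qed

lemma cell_component_measurable:
  assumes "s \<in> V"
  shows "(\<lambda>x. cell n (x s)) \<in> (\<Pi>\<^sub>M v\<in>V. unif01) \<rightarrow>\<^sub>M count_space UNIV"
proof -
  have "(\<lambda>x. x s) \<in> (\<Pi>\<^sub>M v\<in>V. unif01) \<rightarrow>\<^sub>M unif01"
    using assms by (rule measurable_component_singleton)
  then show ?thesis by (rule measurable_compose[OF _ cell_measurable])
qed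

text \<open>Each vertex owns a cell of length $1/n$; the index $0$, which is not a vertex, is attained only at
$x = 0$, so the same bound covers it.\<close>

lemma emeasure_cell_le:
  assumes "n \<ge> 1"
  shows "emeasure unif01 {x \<in> space unif01. cell n x = j} \<le> ennreal (1 / real n)"
proof -
  have sub: "{x \<in> space unif01. cell n x = j} \<subseteq> {(real j - 1) / real n .. real j / real n} \<inter> {0..1}"
  proof
    fix x assume "x \<in> {x \<in> space unif01. cell n x = j}"
    then have x: "x \<in> {0..1}" "nat \<lceil>real n * x\<rceil> = j" by (auto simp: space_unif01 cell_def)
    then have "\<lceil>real n * x\<rceil> \<ge> 0" by (auto simp: le_ceiling_iff intro: less_le_trans[of _ 0])
    with x have "\<lceil>real n * x\<rceil> = int j" by linarith
    then have "real j - 1 < real n * x" "real n * x \<le> real j" by (auto simp: ceiling_eq_iff)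
    with assms x show "x \<in> {(real j - 1) / real n .. real j / real n} \<inter> {0..1}"
      by (auto simp: field_simps)
  qed
  have "emeasure unif01 {x \<in> space unif01. cell n x = j}
      \<le> emeasure unif01 ({(real j - 1) / real n .. real j / real n} \<inter> {0..1})"
    by (rule emeasure_mono[OF sub]) (auto simp: unif01_def sets_restrict_space)
  also have "\<dots> \<le> emeasure lborel {(real j - 1) / real n .. real j / real n}"
    unfolding unif01_def by (subst emeasure_restrict_space) (auto intro!: emeasure_mono)
  also have "\<dots> = ennreal (1 / real n)"
    using assms by (simp add: divide_right_mono flip: diff_divide_distrib)
  finally show ?thesis .
qed

lemma unit_kernel_empirical:
  assumes "a \<in> tournaments n"
  shows "unit_kernel (empirical n a)"
proof -
  have [measurable]: "cell n \<in> unif01 \<rightarrow>\<^sub>M count_space UNIV" by (rule cell_measurable)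
  have "(\<lambda>p. a (cell n (fst p)) (cell n (snd p))) \<in> borel_measurable (unif01 \<Otimes>\<^sub>M unif01)"
  proof (rule measurable_compose_countable[where f = "\<lambda>i p. a i (cell n (snd p))"])
    fix i
    show "(\<lambda>p. a i (cell n (snd p))) \<in> borel_measurable (unif01 \<Otimes>\<^sub>M unif01)"
      by (rule measurable_compose_countable[where f = "\<lambda>j p. a i j"]) measurable
  qed measurable
  then show ?thesis
    using tournaments_unit[OF assms]
    by (simp add: unit_kernel_def empirical_def case_prod_beta' cell_def)
qed

text \<open>Integrate first over the coordinate at $s$: its cell must hit a value \<open>g x\<close> that does not depend
on it. Used with \<open>g\<close> the cell of another coordinate and with \<open>g = 0\<close>.\<close>

lemma cell_collision_le:
  fixes g :: "('v \<Rightarrow> real) \<Rightarrow> nat"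
  assumes n: "n \<ge> 1" and V: "finite V" "s \<in> V"
    and g: "g \<in> (\<Pi>\<^sub>M v\<in>V. unif01) \<rightarrow>\<^sub>M count_space UNIV"
    and gs: "\<And>x y. g (x(s := y)) = g x"
  shows "{x \<in> space (\<Pi>\<^sub>M v\<in>V. unif01). cell n (x s) = g x} \<in> sets (\<Pi>\<^sub>M v\<in>V. unif01)"
      (is "?B \<in> _")
    and "measure (\<Pi>\<^sub>M v\<in>V. unif01) {x \<in> space (\<Pi>\<^sub>M v\<in>V. unif01). cell n (x s) = g x} \<le> 1 / n"
proof -
  interpret product_sigma_finite "\<lambda>_::'v. unif01"
    using prob_space_unif01 by (intro product_sigma_finite.intro prob_space_imp_sigma_finite)
  interpret P: prob_space "\<Pi>\<^sub>M v\<in>V. unif01" by (rule prob_space_PiM_unif01)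
  interpret Q: prob_space "\<Pi>\<^sub>M v\<in>V - {s}. unif01" by (rule prob_space_PiM_unif01)
  have [measurable]: "(\<lambda>x. cell n (x s)) \<in> (\<Pi>\<^sub>M v\<in>V. unif01) \<rightarrow>\<^sub>M count_space UNIV"
    using V(2) by (rule cell_component_measurable)
  note [measurable] = g
  show B: "?B \<in> sets (\<Pi>\<^sub>M v\<in>V. unif01)" by measurable
  have ins: "insert s (V - {s}) = V" using V by auto
  have "emeasure (\<Pi>\<^sub>M v\<in>V. unif01) ?B = (\<integral>\<^sup>+x. indicator ?B x \<partial>(\<Pi>\<^sub>M v\<in>V. unif01))"
    using B by simp
  also have "\<dots> = (\<integral>\<^sup>+x. \<integral>\<^sup>+y. indicator ?B (x(s := y)) \<partial>unif01 \<partial>(\<Pi>\<^sub>M v\<in>V - {s}. unif01))"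
    by (rule product_nn_integral_insert[of "V - {s}" s "indicator ?B", unfolded ins])
       (use B V in auto)
  also have "\<dots> \<le> (\<integral>\<^sup>+x. ennreal (1 / real n) \<partial>(\<Pi>\<^sub>M v\<in>V - {s}. unif01))"
  proof (rule nn_integral_mono)
    fix x :: "'v \<Rightarrow> real"
    let ?C = "{y \<in> space unif01. cell n y = g x}"
    have C: "?C \<in> sets unif01" using cell_measurable[of n] by measurable
    have "(\<integral>\<^sup>+y. indicator ?B (x(s := y)) \<partial>unif01) \<le> (\<integral>\<^sup>+y. indicator ?C y \<partial>unif01)"
      by (rule nn_integral_mono) (auto simp: indicator_def gs)
    also have "\<dots> \<le> ennreal (1 / real n)"
      using emeasure_cell_le[OF n] C by simp
    finally show "(\<integral>\<^sup>+y. indicator ?B (x(s := y)) \<partial>unif01) \<le> ennreal (1 / real n)" .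
  qed
  also have "\<dots> = ennreal (1 / real n)" by (simp add: Q.emeasure_space_1)
  finally show "measure (\<Pi>\<^sub>M v\<in>V. unif01) ?B \<le> 1 / n"
    by (simp add: P.emeasure_eq_measure)
qed

text \<open>Choose the points of $[0,1]^{V(H)}$ first and average over the tournament afterwards. If the points
fall into distinct cells of positive index, the average is exactly the density in $W$ by
\<open>expectation_arc_prod\<close>; only the other points, where the artificial diagonal value $1/2$ may appear,
can produce a bias. A union
bound over pairs of coordinates gives at most $|V(H)|^2/n$ for their probability.\<close>

lemma expectation_hom_density:
  fixes H :: "'v pair_pre_digraph"
  assumes W: "tournamenton W" and H: "oriented_graph H" and n: "n \<ge> 1"
  shows "\<bar>(\<integral>a. hom_density H (empirical n a) \<partial>random_tournament n W) - hom_density H W\<bar>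
    \<le> (card (pverts H))\<^sup>2 / n"
proof -
  let ?V = "pverts H" and ?A = "parcs H" and ?R = "random_tournament n W"
  let ?P = "\<Pi>\<^sub>M v\<in>?V. unif01"
  interpret R: prob_space ?R by (rule prob_space_random_tournament[OF W])
  interpret P: prob_space ?P by (rule prob_space_PiM_unif01)
  note Hd = oriented_graphD[OF H] and U = unit_kernel_tournamenton[OF W]
  note E = random_tournament_integral[OF W]
  let ?t = "hom_density H W"
  let ?f = "\<lambda>a x. arc_prod ?A a (\<lambda>s. cell n (x s))"
  define e where "e x = (\<integral>a. ?f a x \<partial>?R)" for x
  have fe: "?f a x = arc_prod ?A (empirical n a) x" for a x
    by (simp add: arc_prod_def empirical_def cell_def)
  have fi: "integrable ?P (?f a)" if "a \<in> tournaments n" for a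
    using arc_prod_integrable[OF unit_kernel_empirical[OF that] Hd(2)] by (simp add: fe)
  have f01: "?f a x \<in> {0..1}" if "a \<in> tournaments n" for a x
    by (rule arc_prod_unit) (use tournaments_unit[OF that] in auto)
  have es: "e = (\<lambda>x. \<Sum>a\<in>tournaments n. measure ?R {a} * ?f a x)"
    unfolding e_def E(2) ..
  have ei: "integrable ?P e"
    unfolding es by (intro Bochner_Integration.integrable_sum integrable_mult_right fi)
  have "(\<integral>a. hom_density H (empirical n a) \<partial>?R)
      = (\<Sum>a\<in>tournaments n. measure ?R {a} * (\<integral>x. ?f a x \<partial>?P))"
    unfolding E(2) hom_density_arc_prod fe ..
  also have "\<dots> = (\<integral>x. e x \<partial>?P)"
    unfolding es using fi by (subst Bochner_Integration.integral_sum) auto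
  finally have mean: "(\<integral>a. hom_density H (empirical n a) \<partial>?R) = (\<integral>x. e x \<partial>?P)" .
  \<comment> \<open>The pair (s, t) with s and t distinct stands for a collision; the pair (s, s) stands for the cell of s being the non-vertex 0.\<close>
  define B where "B p = {x \<in> space ?P. cell n (x (fst p)) =
      (if fst p = snd p then 0 else cell n (x (snd p)))}" for p
  have B: "B p \<in> sets ?P" "measure ?P (B p) \<le> 1 / n" if p: "p \<in> ?V \<times> ?V" for p
  proof -
    let ?g = "\<lambda>x. if fst p = snd p then 0 else cell n (x (snd p))"
    have g: "?g \<in> ?P \<rightarrow>\<^sub>M count_space UNIV"
      using p by (cases "fst p = snd p") (auto simp: cell_component_measurable)
    show "B p \<in> sets ?P" "measure ?P (B p) \<le> 1 / n"
      unfolding B_def by (rule cell_collision_le[OF n Hd(1) _ g]; use p in auto)+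
  qed
  let ?B = "\<Union>p\<in>?V \<times> ?V. B p"
  have Bm: "?B \<in> sets ?P" using B(1) Hd(1) by (intro sets.finite_UN) auto
  have e01: "e x \<in> {0..1}" for x
  proof -
    have "AE a in ?R. ?f a x \<in> {0..1}"
      using AE_tournaments[OF W, of n] f01 by (auto elim!: AE_mp)
    then show ?thesis
      unfolding e_def using E(1)
      by (auto intro!: R.integral_le_const integral_nonneg_AE)
  qed
  have good: "e x = ?t" if x: "x \<in> space ?P" "x \<notin> ?B" for x
  proof -
    let ?k = "\<lambda>s. cell n (x s)"
    have inj: "inj_on ?k ?V"
    proof (rule inj_onI, rule ccontr)
      fix s t assume "s \<in> ?V" "t \<in> ?V" "?k s = ?k t" "s \<noteq> t"
      then have "x \<in> B (s, t)" using x(1) by (simp add: B_def)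
      with \<open>s \<in> ?V\<close> \<open>t \<in> ?V\<close> x(2) show False by blast
    qed
    have range: "?k ` ?V \<subseteq> {1..n}"
    proof clarify
      fix s assume s: "s \<in> ?V"
      then have "x \<notin> B (s, s)" using x(2) by blast
      then have "?k s \<noteq> 0" using x(1) by (simp add: B_def)
      moreover have "x s \<in> {0..1}"
        using x(1) s by (auto simp: space_PiM space_unif01 PiE_iff)
      ultimately show "?k s \<in> {1..n}" using cell_le[of "x s" n] by simp
    qed
    have "e x = (\<integral>a. arc_prod (parcs (map_digraph ?k H)) a (\<lambda>s. s) \<partial>?R)"
      unfolding e_def by (simp add: map_digraph_def arc_prod_map[OF Hd(2) inj])
    also have "\<dots> = hom_density (map_digraph ?k H) W"
      by (rule expectation_arc_prod[OF W oriented_map_digraph[OF H inj]])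
         (use range in \<open>simp add: map_digraph_def\<close>)
    also have "\<dots> = ?t" by (rule hom_density_map[OF U Hd(2) inj])
    finally show ?thesis .
  qed
  have "\<bar>(\<integral>x. e x \<partial>?P) - ?t\<bar> = \<bar>\<integral>x. e x - ?t \<partial>?P\<bar>"
    using ei by (simp add: P.prob_space)
  also have "\<dots> \<le> (\<integral>x. \<bar>e x - ?t\<bar> \<partial>?P)"
    by (rule integral_abs_bound)
  also have "\<dots> \<le> (\<integral>x. indicator ?B x \<partial>?P)"
  proof (rule integral_mono)
    fix x assume x: "x \<in> space ?P"
    show "\<bar>e x - ?t\<bar> \<le> indicator ?B x"
      using good[OF x] e01[of x] hom_density_unit[OF U Hd(2)]
      by (cases "x \<in> ?B") auto
  qed (use ei Bm in \<open>auto intro!: integrable_real_indicator simp: less_top[symmetric]\<close>)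
  also have "\<dots> = measure ?P ?B" using Bm by simp
  also have "\<dots> \<le> (\<Sum>p\<in>?V \<times> ?V. measure ?P (B p))"
    using B(1) Hd(1) by (intro measure_UNION_le) auto
  also have "\<dots> \<le> (\<Sum>p\<in>?V \<times> ?V. 1 / n)"
    by (intro sum_mono B(2))
  also have "\<dots> = (card ?V)\<^sup>2 / n"
    by (simp add: card_cartesian_product power2_eq_square)
  finally show ?thesis unfolding mean .
qed

text \<open>Squaring a density doubles the graph, so expanding the square leaves only first moments of the graph
and of its double, both controlled by the bias bound.\<close>

lemma second_moment_hom_density:
  fixes H :: "'v pair_pre_digraph"
  assumes W: "tournamenton W" and H: "oriented_graph H" and n: "n \<ge> 1"
  shows "(\<integral>a. (hom_density H (empirical n a) - hom_density H W)\<^sup>2 \<partial>random_tournament n W)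
    \<le> 6 * (card (pverts H))\<^sup>2 / n"
proof -
  let ?R = "random_tournament n W" and ?k = "real ((card (pverts H))\<^sup>2)"
  interpret R: prob_space ?R by (rule prob_space_random_tournament[OF W])
  note Hd = oriented_graphD[OF H] and U = unit_kernel_tournamenton[OF W]
  note i = random_tournament_integral(1)[OF W]
  define t where "t = hom_density H W"
  define X where "X = (\<lambda>a. hom_density H (empirical n a))"
  define Y where "Y = (\<lambda>a. hom_density (double_digraph H) (empirical n a))"
  have t01: "t \<in> {0..1}" unfolding t_def by (rule hom_density_unit[OF U Hd(2)])
  have EX: "\<bar>R.expectation X - t\<bar> \<le> ?k / n"
    using expectation_hom_density[OF W H n] by (simp add: X_def t_def)
  have "card (pverts (double_digraph H)) = 2 * card (pverts H)"
    using Hd(1) by (simp add: double_digraph_def card_Plus)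
  then have EY: "\<bar>R.expectation Y - t\<^sup>2\<bar> \<le> 4 * ?k / n"
    using expectation_hom_density[OF W oriented_double_digraph[OF H] n]
    by (simp add: Y_def t_def hom_density_double[OF U H] power_mult_distrib)
  have "(\<integral>a. (X a - t)\<^sup>2 \<partial>?R) = (\<integral>a. Y a - 2 * t * X a + t\<^sup>2 \<partial>?R)"
  proof (rule integral_cong_AE)
    show "AE a in ?R. (X a - t)\<^sup>2 = Y a - 2 * t * X a + t\<^sup>2"
      using AE_tournaments[OF W, of n]
    proof (rule AE_mp, intro AE_I2 impI)
      fix a assume "a \<in> tournaments n"
      then have "Y a = (X a)\<^sup>2"
        unfolding X_def Y_def by (rule hom_density_double[OF unit_kernel_empirical H])
      then show "(X a - t)\<^sup>2 = Y a - 2 * t * X a + t\<^sup>2" by (simp add: power2_diff)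
    qed
  qed (simp_all add: random_tournament_space[OF W])
  also have "\<dots> = R.expectation Y - 2 * t * R.expectation X + t\<^sup>2"
    using i by (simp add: R.prob_space)
  also have "\<dots> = (R.expectation Y - t\<^sup>2) - 2 * t * (R.expectation X - t)"
    by (simp add: algebra_simps power2_eq_square)
  also have "\<dots> \<le> \<bar>R.expectation Y - t\<^sup>2\<bar> + 2 * (t * \<bar>R.expectation X - t\<bar>)"
  proof -
    have "- (t * (R.expectation X - t)) \<le> \<bar>t * (R.expectation X - t)\<bar>" by simp
    also have "\<dots> = t * \<bar>R.expectation X - t\<bar>" using t01 by (simp add: abs_mult)
    finally show ?thesis by linarith
  qed
  also have "\<dots> \<le> 4 * ?k / n + 2 * (1 * (?k / n))"
    using EX EY t01 by (intro add_mono mult_left_mono mult_mono) auto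
  finally show ?thesis by (simp add: X_def t_def)
qed

section \<open>The variance estimator\<close>

lemma oriented_C3: "oriented_graph C3" and card_C3: "card (pverts C3) = 3"
  by (auto simp: oriented_graph_def C3_def)

lemma oriented_bowtie: "oriented_graph bowtie" and card_bowtie: "card (pverts bowtie) = 5"
  by (auto simp: oriented_graph_def bowtie_def)

text \<open>The mean minimises the mean squared deviation, so replacing the mean $t(\vec C_3, W^{T_n})$ of the
empirical triangle density by the constant $c = t(\vec C_3, W)$ bounds the estimator from above by an expression that is linear in
densities. In the regular case its limiting value is $\sigma_W^2 = 0$, so that its expectation is a
pure bias term: at most $25/n$ from $\vec B$ and $2 \cdot 9/n$ from $\vec C_3$.\<close>

lemma expectation_sigma2_tri_regular:
  assumes W: "tournamenton W" and reg: "tri_regular W" and n: "n \<ge> 1"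
  shows "(\<integral>a. \<bar>real n * sigma2 (empirical n a)\<bar> \<partial>random_tournament n W) \<le> 43"
proof -
  let ?R = "random_tournament n W"
  interpret R: prob_space ?R by (rule prob_space_random_tournament[OF W])
  note U = unit_kernel_tournamenton[OF W] and i = random_tournament_integral(1)[OF W]
  define c where "c = hom_density C3 W"
  define X where "X = (\<lambda>a. hom_density C3 (empirical n a))"
  define Y where "Y = (\<lambda>a. hom_density bowtie (empirical n a))"
  have c01: "c \<in> {0..1}"
    unfolding c_def by (rule hom_density_unit[OF U oriented_graphD(2)[OF oriented_C3]])
  have c2: "hom_density bowtie W = c\<^sup>2"
    using sigma2_eq_0_iff_tri_regular[OF U] reg by (simp add: sigma2_def c_def)
  have EX: "\<bar>R.expectation X - c\<bar> \<le> 9 / n"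
    using expectation_hom_density[OF W oriented_C3 n] by (simp add: X_def c_def card_C3)
  have EY: "\<bar>R.expectation Y - c\<^sup>2\<bar> \<le> 25 / n"
    using expectation_hom_density[OF W oriented_bowtie n] by (simp add: Y_def c2 card_bowtie)
  have "(\<integral>a. \<bar>real n * sigma2 (empirical n a)\<bar> \<partial>?R)
      \<le> (\<integral>a. real n * (Y a - 2 * c * X a + c\<^sup>2) \<partial>?R)"
  proof (rule integral_mono_AE[OF i i])
    show "AE a in ?R. \<bar>real n * sigma2 (empirical n a)\<bar> \<le> real n * (Y a - 2 * c * X a + c\<^sup>2)"
      using AE_tournaments[OF W, of n]
    proof (rule AE_mp, intro AE_I2 impI)
      fix a assume a: "a \<in> tournaments n"
      have "Y a - 2 * c * X a + c\<^sup>2 = sigma2 (empirical n a) + (X a - c)\<^sup>2"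
        by (simp add: sigma2_def X_def Y_def power2_diff)
      then have "sigma2 (empirical n a) \<le> Y a - 2 * c * X a + c\<^sup>2" by simp
      then show "\<bar>real n * sigma2 (empirical n a)\<bar> \<le> real n * (Y a - 2 * c * X a + c\<^sup>2)"
        using sigma2_nonneg[OF unit_kernel_empirical[OF a]] by (simp add: mult_left_mono)
    qed
  qed
  also have "\<dots> = real n * ((R.expectation Y - c\<^sup>2) - 2 * (c * (R.expectation X - c)))"
    using i by (simp add: R.prob_space algebra_simps power2_eq_square)
  also have "\<dots> \<le> real n * (25 / n + 2 * (1 * (9 / n)))"
  proof -
    have "\<bar>c * (R.expectation X - c)\<bar> \<le> 1 * (9 / n)"
      unfolding abs_mult using c01 EX by (intro mult_mono) auto
    then show ?thesis using EY by (intro mult_left_mono) linarith+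
  qed
  also have "\<dots> = 43" using n by simp
  finally show ?thesis .
qed

text \<open>Writing $Y$ and $X$ for the errors of the densities of $\vec B$ and $\vec C_3$, the error of the
estimator is $Y - X s$ with $0 \le s \le 2$.\<close>

lemma second_moment_sigma2:
  assumes W: "tournamenton W" and n: "n \<ge> 1"
  shows "(\<integral>a. (sigma2 (empirical n a) - sigma2 W)\<^sup>2 \<partial>random_tournament n W) \<le> 732 / n"
proof -
  let ?R = "random_tournament n W"
  note U = unit_kernel_tournamenton[OF W] and i = random_tournament_integral(1)[OF W]
  define X where "X = (\<lambda>a. hom_density C3 (empirical n a) - hom_density C3 W)"
  define Y where "Y = (\<lambda>a. hom_density bowtie (empirical n a) - hom_density bowtie W)"
  note C01 = hom_density_unit[OF _ oriented_graphD(2)[OF oriented_C3]]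
  have "(\<integral>a. (sigma2 (empirical n a) - sigma2 W)\<^sup>2 \<partial>?R) \<le> (\<integral>a. 2 * (Y a)\<^sup>2 + 8 * (X a)\<^sup>2 \<partial>?R)"
  proof (rule integral_mono_AE[OF i i])
    show "AE a in ?R. (sigma2 (empirical n a) - sigma2 W)\<^sup>2 \<le> 2 * (Y a)\<^sup>2 + 8 * (X a)\<^sup>2"
      using AE_tournaments[OF W, of n]
    proof (rule AE_mp, intro AE_I2 impI)
      fix a assume a: "a \<in> tournaments n"
      let ?s = "hom_density C3 (empirical n a) + hom_density C3 W"
      have "?s \<in> {0..2}" using C01[OF U] C01[OF unit_kernel_empirical[OF a]] by auto
      then have s: "?s\<^sup>2 \<le> 2\<^sup>2" by (intro power_mono) auto
      have "sigma2 (empirical n a) - sigma2 W = Y a - X a * ?s"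
        by (simp add: sigma2_def X_def Y_def power2_eq_square algebra_simps)
      then have "(sigma2 (empirical n a) - sigma2 W)\<^sup>2 = (Y a - X a * ?s)\<^sup>2" by simp
      also have "\<dots> \<le> 2 * (Y a)\<^sup>2 + 2 * (X a * ?s)\<^sup>2"
        using zero_le_power2[of "Y a + X a * ?s"] by (simp add: power2_sum power2_diff)
      also have "(X a * ?s)\<^sup>2 \<le> (X a)\<^sup>2 * 2\<^sup>2"
        unfolding power_mult_distrib using s by (intro mult_left_mono) auto
      finally show "(sigma2 (empirical n a) - sigma2 W)\<^sup>2 \<le> 2 * (Y a)\<^sup>2 + 8 * (X a)\<^sup>2" by simp
    qed
  qed
  also have "\<dots> = 2 * (\<integral>a. (Y a)\<^sup>2 \<partial>?R) + 8 * (\<integral>a. (X a)\<^sup>2 \<partial>?R)"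
    using i by simp
  also have "\<dots> \<le> 2 * (6 * 5\<^sup>2 / n) + 8 * (6 * 3\<^sup>2 / n)"
    using second_moment_hom_density[OF W oriented_C3 n]
      second_moment_hom_density[OF W oriented_bowtie n]
    unfolding X_def Y_def by (intro add_mono mult_left_mono) (simp_all add: card_C3 card_bowtie)
  finally show ?thesis by simp
qed

lemma measure_sampled_tournament:
  assumes "tournamenton W" "T \<in> measurable M (count_space UNIV)"
    and "distr M (count_space UNIV) T = random_tournament n W"
  shows "measure M {\<omega> \<in> space M. Q (T \<omega>)} = measure (random_tournament n W) {a. Q a}"
proof -
  have "measure (random_tournament n W) {a. Q a} = measure M (T -` {a. Q a} \<inter> space M)"
    unfolding assms(3)[symmetric] by (rule measure_distr[OF assms(2)]) simp
  also have "T -` {a. Q a} \<inter> space M = {\<omega> \<in> space M. Q (T \<omega>)}" by auto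
  finally show ?thesis by simp
qed

theorem proposition4p1:
  fixes W :: "real \<Rightarrow> real \<Rightarrow> real"
    and M :: "nat \<Rightarrow> 'w measure"
    and T :: "nat \<Rightarrow> 'w \<Rightarrow> nat \<Rightarrow> nat \<Rightarrow> real"
  assumes "tournamenton W"
    and "\<And>n. n \<ge> 1 \<Longrightarrow> prob_space (M n)"
    and "\<And>n. n \<ge> 1 \<Longrightarrow> T n \<in> measurable (M n) (count_space UNIV)"
    and "\<And>n. n \<ge> 1 \<Longrightarrow> distr (M n) (count_space UNIV) (T n) = random_tournament n W"
  shows "(tri_regular W \<longrightarrow>
           bounded_in_prob M (\<lambda>n \<omega>. real n * sigma2 (empirical n (T n \<omega>)))) \<and>
         (\<not> tri_regular W \<longrightarrow>
           tendsto_in_prob M (\<lambda>n \<omega>. sigma2 (empirical n (T n \<omega>))) (sigma2 W) \<and> sigma2 W > 0)"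
proof (intro conjI impI)
  note W = assms(1) and T = measure_sampled_tournament[OF assms(1,3,4)]
  note U = unit_kernel_tournamenton[OF W] and i = random_tournament_integral(1)[OF W]
  note sp = random_tournament_space[OF W]
  {
    assume reg: "tri_regular W"
    \<comment> \<open>Markov bounds the tail beyond 44 / \<epsilon> by (43 / 44) \<epsilon>, which is strictly below \<epsilon>.\<close>
    have "measure (M n) {\<omega> \<in> space (M n). \<bar>real n * sigma2 (empirical n (T n \<omega>))\<bar> > 44 / \<epsilon>} < \<epsilon>"
      if \<epsilon>: "\<epsilon> > 0" and n: "n \<ge> 1" for \<epsilon> n
    proof -
      let ?R = "random_tournament n W"
      interpret R: prob_space ?R by (rule prob_space_random_tournament[OF W])
      let ?X = "\<lambda>a. \<bar>real n * sigma2 (empirical n a)\<bar>"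
      have "measure ?R {a. ?X a > 44 / \<epsilon>} \<le> measure ?R {a \<in> space ?R. ?X a \<ge> 44 / \<epsilon>}"
        by (rule R.finite_measure_mono) (auto simp: sp prob_space_random_tournament(2)[OF W])
      also have "\<dots> \<le> (\<integral>a. ?X a \<partial>?R) / (44 / \<epsilon>)"
        by (rule integral_Markov_inequality_measure[OF i sets.top]) (use \<epsilon> in auto)
      also have "\<dots> \<le> 43 / (44 / \<epsilon>)"
        using expectation_sigma2_tri_regular[OF W reg n] \<epsilon> by (intro divide_right_mono) auto
      also have "\<dots> < \<epsilon>" using \<epsilon> by simp
      finally show ?thesis by (subst T[OF n n])
    qed
    then show "bounded_in_prob M (\<lambda>n \<omega>. real n * sigma2 (empirical n (T n \<omega>)))"
      unfolding bounded_in_prob_def eventually_sequentially by blast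
  next
    assume irr: "\<not> tri_regular W"
    show "sigma2 W > 0"
      using sigma2_nonneg[OF U] sigma2_eq_0_iff_tri_regular[OF U] irr by linarith
    have bound: "measure (M n) {\<omega> \<in> space (M n). \<bar>sigma2 (empirical n (T n \<omega>)) - sigma2 W\<bar> > \<epsilon>}
        \<le> (732 / n) / \<epsilon>\<^sup>2" if \<epsilon>: "\<epsilon> > 0" and n: "n \<ge> 1" for \<epsilon> n
    proof -
      let ?R = "random_tournament n W"
      interpret R: prob_space ?R by (rule prob_space_random_tournament[OF W])
      let ?X = "\<lambda>a. sigma2 (empirical n a) - sigma2 W"
      have "measure ?R {a. \<bar>?X a\<bar> > \<epsilon>} \<le> measure ?R {a \<in> space ?R. \<bar>?X a\<bar> \<ge> \<epsilon>}"
        by (rule R.finite_measure_mono) (auto simp: sp prob_space_random_tournament(2)[OF W])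
      also have "\<dots> \<le> (\<integral>a. (?X a)\<^sup>2 \<partial>?R) / \<epsilon>\<^sup>2"
        by (rule R.second_moment_method[OF _ i \<epsilon>]) (simp add: sp)
      also have "\<dots> \<le> (732 / n) / \<epsilon>\<^sup>2"
        using second_moment_sigma2[OF W n] by (intro divide_right_mono) auto
      finally show ?thesis by (subst T[OF n n])
    qed
    show "tendsto_in_prob M (\<lambda>n \<omega>. sigma2 (empirical n (T n \<omega>))) (sigma2 W)"
      unfolding tendsto_in_prob_def
    proof (intro allI impI)
      fix \<epsilon> :: real assume \<epsilon>: "\<epsilon> > 0"
      have "(\<lambda>n. (732 / real n) / \<epsilon>\<^sup>2) \<longlonglongrightarrow> 0 / \<epsilon>\<^sup>2"
        by (intro tendsto_divide lim_const_over_n tendsto_const) (use \<epsilon> in auto)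
      then have lim: "(\<lambda>n. (732 / real n) / \<epsilon>\<^sup>2) \<longlonglongrightarrow> 0" by simp
      show "(\<lambda>n. measure (M n)
          {\<omega> \<in> space (M n). \<bar>sigma2 (empirical n (T n \<omega>)) - sigma2 W\<bar> > \<epsilon>}) \<longlonglongrightarrow> 0"
        by (rule tendsto_sandwich[OF _ _ tendsto_const lim])
           (auto simp: eventually_sequentially intro!: exI[of _ 1] bound[OF \<epsilon>, simplified])
    qed
  }
qed

end
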